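(* Let $\Gamma=\Gamma(B)$ be the quiver of a cluster-tilted algebra of Dynkin type $A_n$, let $k$ be a vertex of $\Gamma$, let $\Gamma'$ be the quiver obtained from $\Gamma$ by mutating at $k$, let $\Psi=\{\gamma_x:x\in\Gamma_0\}$ be a companion basis for $\Gamma$, and let $\Psi'$ be the companion basis for $\Gamma'$ obtained from $\Psi$ by mutating inwardly at $k$. Let $\alpha\in\Phi^+$ and suppose that $d_\alpha^\Psi=(d_x)_{x\in\Gamma_0}$. Then $d_\alpha^{\Psi'}$ is given by $$\left(d_\alpha^{\Psi'}\right)_z=\begin{cases} d_z & \text{if } z\neq k,\\ \left|-d_k+\sum_{x\to k}d_x\right| & \text{if } z=k,\end{cases}$$ where the sum is over all vertices $x$ such that there is an arrow from $x$ to $k$ in $\Gamma$.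
   Context: For a skew-symmetric integer matrix $B=(b_{xy})$ and an index $k$, the mutation of $B$ at $k$ is $B'=(b'_{xy})$ with $b'_{xy}=-b_{xy}$ if $x=k$ or $y=k$, and $b'_{xy}=b_{xy}+\frac{|b_{xk}|b_{ky}+b_{xk}|b_{ky}|}{2}$ otherwise; mutation equivalence means being connected by finitely many mutations. The Cartan counterpart of $B$ has diagonal entries $2$ and off-diagonal entries $-|b_{xy}|$. Fix $n\ge1$ and a skew-symmetric integer matrix $B$, with rows and columns indexed by an $n$-element set $\Gamma_0$, which is an exchange matrix of the cluster algebra of type $A_n$, i.e. $B$ is mutation equivalent to a matrix $B_0$ whose Cartan counterpart is the Cartan matrix of type $A_n$. (All entries of $B$ then lie in $\{0,\pm1\}$.) Let $\Gamma=\Gamma(B)$ be the quiver with vertex set $\Gamma_0$ and an arrow $x\to y$ whenever $b_{xy}>0$; these are exactly the quivers of the cluster-tilted algebras of type $A_n$. The quiver obtained from $\Gamma$ by mutating at $k$ is $\Gamma'=\Gamma(B')$, where $B'$ is the mutation of $B$ at $k$; its vertex set $\Gamma_0'$ is identified with $\Gamma_0$. Let $V$ be a Euclidean space with positive definite symmetric bilinear form $(\;,\;)$, and let $\Phi\subseteq V$ be the root system of type $A_n$ (spanning $V$), normalised so that $(\alpha,\alpha)=2$ for every root, with positive roots $\Phi^+$. For a root $\gamma$, $s_\gamma(v)=v-(v,\gamma)\gamma$. A quasi-Cartan companion of $B$ is a (here symmetric) integer matrix $A=(a_{xy})$ with $a_{xx}=2$ for all $x$ and $|a_{xy}|=|b_{xy}|$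 for all $x\ne y$; it is positive if it is positive definite. A companion basis for $\Gamma(B)$ is a subset $\{\gamma_x:x\in\Gamma_0\}\subseteq\Phi$, indexed by the vertices, which is a $\mathbb Z$-basis of $\mathbb Z\Phi$ and is such that $A=((\gamma_x,\gamma_y))_{x,y}$ is a positive quasi-Cartan companion of $B$. For such $\Psi=\{\gamma_x\}$ and $\alpha=\sum_x c_x\gamma_x\in\Phi$ with $c_x\in\mathbb Z$, put $d_\alpha^\Psi=(|c_x|)_{x\in\Gamma_0}$. The companion basis $\Psi'=\{\gamma_x':x\in\Gamma_0'\}$ for $\Gamma'$ obtained from $\Psi$ by mutating inwardly at $k$ is given by $\gamma_x'=s_{\gamma_k}(\gamma_x)$ if there is an arrow $x\to k$ in $\Gamma$, and $\gamma_x'=\gamma_x$ otherwise. *)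

theory Defs
  imports "HOL-Analysis.Analysis"
begin

section \<open>Exchange matrices of type A and their quivers\<close>

text \<open>
  The \<open>n\<close>-element index set \<open>\<Gamma>\<^sub>0\<close> is a finite type \<open>'v\<close> with \<open>n = CARD('v)\<close>; \<open>n \<ge> 1\<close> is automatic.
\<close>

definition skew_symmetric :: "int ^ 'v ^ 'v \<Rightarrow> bool" where
  "skew_symmetric B \<longleftrightarrow> transpose B = - B"

text \<open>The integer division by 2 is exact: the dividend is \<open>0\<close> or \<open>\<plusminus>2 b\<^sub>x\<^sub>k b\<^sub>k\<^sub>y\<close>.\<close>

definition mutation :: "'v \<Rightarrow> int ^ 'v ^ 'v \<Rightarrow> int ^ 'v ^ 'v" where
  "mutation k B = (\<chi> x y.
     if x = k \<or> y = k then - B $ x $ y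
     else B $ x $ y + (\<bar>B $ x $ k\<bar> * B $ k $ y + B $ x $ k * \<bar>B $ k $ y\<bar>) div 2)"

text \<open>
  Mutation at a fixed index is an involution on skew-symmetric matrices, so on these the
  reflexive transitive closure is an equivalence relation.
\<close>

definition mutation_equivalent :: "int ^ 'v ^ 'v \<Rightarrow> int ^ 'v ^ 'v \<Rightarrow> bool" where
  "mutation_equivalent = (\<lambda>B B'. \<exists>k. B' = mutation k B)\<^sup>*\<^sup>*"

definition cartan_counterpart :: "int ^ 'v ^ 'v \<Rightarrow> int ^ 'v ^ 'v" where
  "cartan_counterpart B = (\<chi> x y. if x = y then 2 else - \<bar>B $ x $ y\<bar>)"

definition cartan_matrix_A :: "nat \<Rightarrow> nat \<Rightarrow> int" where
  "cartan_matrix_A i j = (if i = j then 2 else if i = Suc j \<or> j = Suc i then - 1 else 0)"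

text \<open>
  Cartan matrices are considered up to a simultaneous relabelling of rows and columns; the labels
  of type \<open>A\<^sub>n\<close> are \<open>0, \<dots>, n - 1\<close>.
\<close>

definition exchange_matrix_A :: "int ^ 'v ^ 'v \<Rightarrow> bool" where
  "exchange_matrix_A B \<longleftrightarrow> skew_symmetric B \<and>
     (\<exists>B\<^sub>0 e. skew_symmetric B\<^sub>0 \<and> mutation_equivalent B B\<^sub>0 \<and>
        bij_betw e (UNIV :: 'v set) {..<CARD('v)} \<and>
        (\<forall>x y. cartan_counterpart B\<^sub>0 $ x $ y = cartan_matrix_A (e x) (e y)))"

text \<open>The quiver \<open>\<Gamma>(B)\<close> has vertex set \<open>UNIV :: 'v set\<close> and is given by its set of arrows.\<close>

definition quiver :: "int ^ 'v ^ 'v \<Rightarrow> ('v \<times> 'v) set" where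
  "quiver B = {(x, y). B $ x $ y > 0}"


section \<open>Root systems\<close>

definition root_system :: "'a::euclidean_space set \<Rightarrow> bool" where
  "root_system \<Phi> \<longleftrightarrow> finite \<Phi> \<and> 0 \<notin> \<Phi> \<and> span \<Phi> = UNIV \<and>
     (\<forall>\<alpha>\<in>\<Phi>. \<forall>c. c *\<^sub>R \<alpha> \<in> \<Phi> \<longrightarrow> c = 1 \<or> c = - 1) \<and>
     (\<forall>\<alpha>\<in>\<Phi>. \<forall>\<beta>\<in>\<Phi>. \<beta> - (2 * (\<beta> \<bullet> \<alpha>) / (\<alpha> \<bullet> \<alpha>)) *\<^sub>R \<alpha> \<in> \<Phi>) \<and>
     (\<forall>\<alpha>\<in>\<Phi>. \<forall>\<beta>\<in>\<Phi>. 2 * (\<beta> \<bullet> \<alpha>) / (\<alpha> \<bullet> \<alpha>) \<in> \<int>)"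

definition nonneg_int_comb :: "'a::euclidean_space set \<Rightarrow> 'a \<Rightarrow> bool" where
  "nonneg_int_comb \<Delta> v \<longleftrightarrow> (\<exists>c :: 'a \<Rightarrow> nat. v = (\<Sum>\<delta>\<in>\<Delta>. of_nat (c \<delta>) *\<^sub>R \<delta>))"

definition root_base :: "'a::euclidean_space set \<Rightarrow> 'a set \<Rightarrow> bool" where
  "root_base \<Phi> \<Delta> \<longleftrightarrow> \<Delta> \<subseteq> \<Phi> \<and> independent \<Delta> \<and> span \<Delta> = UNIV \<and>
     (\<forall>\<alpha>\<in>\<Phi>. nonneg_int_comb \<Delta> \<alpha> \<or> nonneg_int_comb \<Delta> (- \<alpha>))"

definition positive_roots :: "'a::euclidean_space set \<Rightarrow> 'a set \<Rightarrow> 'a set" where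
  "positive_roots \<Phi> \<Delta> = {\<alpha> \<in> \<Phi>. nonneg_int_comb \<Delta> \<alpha>}"

definition root_system_A :: "nat \<Rightarrow> 'a::euclidean_space set \<Rightarrow> bool" where
  "root_system_A n \<Phi> \<longleftrightarrow> root_system \<Phi> \<and>
     (\<exists>\<Delta> e. root_base \<Phi> \<Delta> \<and> bij_betw e \<Delta> {..<n} \<and>
        (\<forall>\<alpha>\<in>\<Delta>. \<forall>\<beta>\<in>\<Delta>. 2 * (\<alpha> \<bullet> \<beta>) / (\<beta> \<bullet> \<beta>) = of_int (cartan_matrix_A (e \<alpha>) (e \<beta>))))"

text \<open>The normalisation \<open>\<gamma> \<bullet> \<gamma> = 2\<close> of roots is built into the formula.\<close>

definition reflection :: "'a::euclidean_space \<Rightarrow> 'a \<Rightarrow> 'a" where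
  "reflection \<gamma> v = v - (v \<bullet> \<gamma>) *\<^sub>R \<gamma>"


section \<open>Companion bases\<close>

definition quasi_cartan_companion :: "int ^ 'v ^ 'v \<Rightarrow> int ^ 'v ^ 'v \<Rightarrow> bool" where
  "quasi_cartan_companion A B \<longleftrightarrow> transpose A = A \<and> (\<forall>x. A $ x $ x = 2) \<and>
     (\<forall>x y. x \<noteq> y \<longrightarrow> \<bar>A $ x $ y\<bar> = \<bar>B $ x $ y\<bar>)"

definition positive_definite :: "int ^ 'v ^ 'v \<Rightarrow> bool" where
  "positive_definite A \<longleftrightarrow>
     (\<forall>v :: real ^ 'v. v \<noteq> 0 \<longrightarrow> 0 < v \<bullet> ((\<chi> x y. of_int (A $ x $ y)) *v v))"

definition int_scale :: "int \<Rightarrow> 'a::real_vector \<Rightarrow> 'a" where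
  "int_scale c v = of_int c *\<^sub>R v"

lemma module_int_scale: "module int_scale"
  by unfold_locales (simp_all add: int_scale_def algebra_simps)

text \<open>
  \<open>\<int>S\<close> is the span of \<open>S\<close> over \<open>\<int>\<close>. Injectivity in \<^term>\<open>int_basis\<close> makes \<open>\<gamma>\<close> an indexing of the
  basis by the vertices.
\<close>

definition int_basis :: "('v \<Rightarrow> 'a::euclidean_space) \<Rightarrow> 'a set \<Rightarrow> bool" where
  "int_basis \<gamma> S \<longleftrightarrow> inj \<gamma> \<and> \<not> module.dependent int_scale (range \<gamma>) \<and>
     module.span int_scale (range \<gamma>) = module.span int_scale S"

definition companion_basis ::
    "'a::euclidean_space set \<Rightarrow> int ^ 'v ^ 'v \<Rightarrow> ('v \<Rightarrow> 'a) \<Rightarrow> bool" where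
  "companion_basis \<Phi> B \<gamma> \<longleftrightarrow> range \<gamma> \<subseteq> \<Phi> \<and> int_basis \<gamma> \<Phi> \<and>
     (\<exists>A. (\<forall>x y. of_int (A $ x $ y) = \<gamma> x \<bullet> \<gamma> y) \<and>
          quasi_cartan_companion A B \<and> positive_definite A)"

text \<open>
  The vector \<open>d\<^sub>\<alpha>\<^sup>\<Psi>\<close> for \<open>\<Psi> = {\<gamma> x | x}\<close>; the description is proper when \<open>\<gamma>\<close> is a \<open>\<int>\<close>-basis of
  a lattice containing \<open>\<alpha>\<close>.
\<close>

definition dvec :: "('v::finite \<Rightarrow> 'a::euclidean_space) \<Rightarrow> 'a \<Rightarrow> 'v \<Rightarrow> int" where
  "dvec \<gamma> \<alpha> x = \<bar>(THE c :: 'v \<Rightarrow> int. \<alpha> = (\<Sum>y\<in>UNIV. of_int (c y) *\<^sub>R \<gamma> y)) x\<bar>"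

definition mutate_inwardly ::
    "('v \<times> 'v) set \<Rightarrow> 'v \<Rightarrow> ('v \<Rightarrow> 'a::euclidean_space) \<Rightarrow> 'v \<Rightarrow> 'a" where
  "mutate_inwardly \<Gamma> k \<gamma> x = (if (x, k) \<in> \<Gamma> then reflection (\<gamma> k) (\<gamma> x) else \<gamma> x)"

end

theory Submission
  imports Defs
begin

text \<open>
  In the standard model the roots of type \<open>A\<^sub>n\<close> are the vectors \<open>\<epsilon>\<^sub>p - \<epsilon>\<^sub>q\<close> with \<open>p \<noteq> q\<close> among
  \<open>n + 1\<close> points, so a basis of roots is a tree whose edges are the basis elements, and a root is
  the path between two points: its coefficients are \<open>\<plusminus>1\<close> on the edges of the path and \<open>0\<close>
  elsewhere. The coefficients of \<open>\<alpha>\<close> change under inward mutation only at \<open>k\<close>, where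
  \<open>c\<^sub>k\<close> becomes \<open>c\<^sub>k + \<Sum> a\<^sub>x\<^sub>k c\<^sub>x\<close>, summed over the arrows \<open>x \<rightarrow> k\<close>, with \<open>a\<^sub>x\<^sub>k = \<plusminus>1\<close>. What has to
  be shown is that the absolute value of this number depends only on the absolute values of the
  \<open>c\<^sub>x\<close>, in the way that the formula claims. This rests on two facts.

  The first is about quivers: no arrow joins two vertices \<open>x\<close>, \<open>y\<close> with \<open>x \<rightarrow> k \<leftarrow> y\<close>, because all
  triangles are cyclically oriented (\<open>exchange_matrix_triangles_cyclic\<close>). A noncyclic
  triangle is avoided by induction along the mutations that lead to an orientation of the Dynkin diagram, with a
  stronger invariant: the matrix is realised, up to signs, by the inner products of independent
  roots of type \<open>A\<close>. Inward mutation transports the realisation, where cyclicity of the triangles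
  is needed for the new inner products to fit (\<open>realises_mutation\<close>). Conversely, the realisation
  forces the mutated triangles to be cyclic: the only configuration from which mutation could
  create a noncyclic triangle is a square without diagonals, which would be either a
  linear dependence or a copy of the root system of type \<open>D\<^sub>4\<close> (\<open>square_dependent\<close>).

  The second is about roots, and is the path picture in the language of functionals: a linear
  functional that vanishes on all but one member of a spanning family of roots takes, up to
  sign, at most one nonzero value on roots (\<open>functional_values\<close>). It bounds by \<open>1\<close>
  the coefficients of \<open>\<alpha>\<close> in every basis of roots. Applied to the given basis and to a few bases
  obtained from it by reflections, this leaves, for \<open>c\<^sub>k = 0\<close>, at most one nonzero \<open>c\<^sub>x\<close> with
  \<open>x \<rightarrow> k\<close>, and, for \<open>c\<^sub>k \<noteq> 0\<close>, only terms \<open>a\<^sub>x\<^sub>k c\<^sub>x\<close> whose sign is opposite to that of \<open>c\<^sub>k\<close>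
  (\<open>mutated_coefficient\<close>). In both cases the formula is immediate (\<open>abs_sum_signs\<close>).
\<close>

section \<open>Finite independent families\<close>

definition independent_family :: "('v::finite \<Rightarrow> 'a::real_vector) \<Rightarrow> bool" where
  "independent_family \<gamma> \<longleftrightarrow> (\<forall>c. (\<Sum>x\<in>UNIV. c x *\<^sub>R \<gamma> x) = 0 \<longrightarrow> (\<forall>x. c x = 0))"

lemma independent_familyD:
  "independent_family \<gamma> \<Longrightarrow> (\<Sum>x\<in>UNIV. c x *\<^sub>R \<gamma> x) = 0 \<Longrightarrow> c x = 0"
  by (auto simp: independent_family_def)

lemma independent_family_inj:
  fixes \<gamma> :: "'v::finite \<Rightarrow> 'a::real_vector"
  assumes "inj \<gamma>" "independent (range \<gamma>)"
  shows "independent_family \<gamma>"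
  unfolding independent_family_def
proof (intro allI impI)
  fix c x assume eq: "(\<Sum>x\<in>UNIV. c x *\<^sub>R \<gamma> x) = 0"
  have "(\<Sum>v\<in>range \<gamma>. c (inv \<gamma> v) *\<^sub>R v) = (\<Sum>x\<in>UNIV. c x *\<^sub>R \<gamma> x)"
    using assms(1) by (simp add: sum.reindex)
  then have "c (inv \<gamma> (\<gamma> x)) = 0"
    using eq independentD[OF assms(2), of "range \<gamma>" "\<lambda>v. c (inv \<gamma> v)" "\<gamma> x"] by simp
  then show "c x = 0" using assms(1) by simp
qed

text \<open>
  Repetitions among \<open>y\<close>, \<open>z\<close>, \<open>w\<close> are allowed, so that relations between fewer than four members
  are covered by padding with zero coefficients.
\<close>

lemma independent_family_four:
  fixes \<gamma> :: "'v::finite \<Rightarrow> 'a::real_vector"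
  assumes "independent_family \<gamma>"
    and "p *\<^sub>R \<gamma> x + q *\<^sub>R \<gamma> y + r *\<^sub>R \<gamma> z + s *\<^sub>R \<gamma> w = 0"
    and "x \<noteq> y" "x \<noteq> z" "x \<noteq> w"
  shows "p = 0"
proof -
  define c where "c u = (if u = x then p else 0) + (if u = y then q else 0)
    + (if u = z then r else 0) + (if u = w then s else 0)" for u
  have *: "(if u = v then t else 0) *\<^sub>R \<gamma> u = (if u = v then t *\<^sub>R \<gamma> v else 0)" for u v t
    by simp
  have "(\<Sum>u\<in>UNIV. c u *\<^sub>R \<gamma> u) = 0"
    using assms(2) by (simp add: c_def scaleR_left_distrib sum.distrib *)
  then have "c x = 0" by (rule independent_familyD[OF assms(1)])
  then show ?thesis using assms(3-) by (simp add: c_def)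
qed

lemma dual_functionals:
  fixes \<gamma> :: "'v::finite \<Rightarrow> 'a::real_vector"
  assumes "independent_family \<gamma>"
  obtains F :: "'v \<Rightarrow> 'a \<Rightarrow> real"
  where "\<And>x. linear (F x)" "\<And>x y. F x (\<gamma> y) = of_bool (x = y)"
proof -
  have inj: "inj \<gamma>"
  proof (rule injI, rule ccontr)
    fix x y assume "\<gamma> x = \<gamma> y" "x \<noteq> y"
    then show False
      using independent_family_four[OF assms, of 1 x "-1" y 0 y 0 y] by simp
  qed
  have "independent (range \<gamma>)"
    unfolding dependent_finite[OF finite_imageI[OF finite]]
  proof clarify
    fix u x assume "(\<Sum>v\<in>range \<gamma>. u v *\<^sub>R v) = 0" "u (\<gamma> x) \<noteq> 0"
    then show False
      using inj independent_familyD[OF assms, of "\<lambda>x. u (\<gamma> x)" x] by (simp add: sum.reindex)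
  qed
  then have "\<exists>g. linear g \<and> (\<forall>v\<in>range \<gamma>. g v = (of_bool (x = inv \<gamma> v) :: real))" for x
    by (rule linear_independent_extend)
  then obtain F where "linear (F x)" "\<forall>v\<in>range \<gamma>. F x v = (of_bool (x = inv \<gamma> v) :: real)" for x
    by metis
  with inj show ?thesis by (intro that[of F]) auto
qed

text \<open>
  Inward mutation replaces \<open>\<gamma>\<close> by \<open>\<gamma> x - r x \<gamma> k\<close> with \<open>r k = 0\<close>. Such a change moves only the
  coefficient at \<open>k\<close>.
\<close>

lemma transvection_sum:
  fixes \<gamma> :: "'v::finite \<Rightarrow> 'a::real_vector"
  shows "(\<Sum>x\<in>UNIV. c x *\<^sub>R (\<gamma> x - r x *\<^sub>R \<gamma> k)) =
    (\<Sum>x\<in>UNIV. (c(k := c k - (\<Sum>x\<in>UNIV. c x * r x))) x *\<^sub>R \<gamma> x)"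
proof -
  let ?s = "\<Sum>x\<in>UNIV. c x * r x"
  have "(c(k := c k - ?s)) x *\<^sub>R \<gamma> x = c x *\<^sub>R \<gamma> x - (if x = k then ?s *\<^sub>R \<gamma> k else 0)" for x
    by (simp add: scaleR_left_diff_distrib)
  then show ?thesis
    by (simp add: scaleR_right_diff_distrib sum_subtractf scaleR_left.sum)
qed

lemma independent_family_transvection:
  fixes \<gamma> :: "'v::finite \<Rightarrow> 'a::real_vector"
  assumes "independent_family \<gamma>" "r k = 0"
  shows "independent_family (\<lambda>x. \<gamma> x - r x *\<^sub>R \<gamma> k)"
  unfolding independent_family_def transvection_sum
proof (intro allI impI)
  fix c x assume "(\<Sum>x\<in>UNIV. (c(k := c k - (\<Sum>x\<in>UNIV. c x * r x))) x *\<^sub>R \<gamma> x) = 0"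
  from independent_familyD[OF assms(1) this]
  have *: "(c(k := c k - (\<Sum>x\<in>UNIV. c x * r x))) y = 0" for y .
  have off: "c y = 0" if "y \<noteq> k" for y using *[of y] that by simp
  then have "(\<Sum>x\<in>UNIV. c x * r x) = 0"
    using assms(2) by (intro sum.neutral) (metis mult_eq_0_iff)
  then show "c x = 0" using *[of k] off by (cases "x = k") auto
qed

lemma span_range_mono:
  assumes "\<And>x. \<gamma> x \<in> span (range \<eta>)" "span (range \<gamma>) = UNIV"
  shows "span (range \<eta>) = UNIV"
  using span_minimal[of "range \<gamma>" "span (range \<eta>)"] assms by auto

lemma span_transvection:
  fixes \<gamma> :: "'v \<Rightarrow> 'a::real_vector"
  assumes "span (range \<gamma>) = UNIV" "r k = 0"
  shows "span (range (\<lambda>x. \<gamma> x - r x *\<^sub>R \<gamma> k)) = UNIV"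
proof (rule span_range_mono[OF _ assms(1)])
  fix x
  let ?\<eta> = "\<lambda>x. \<gamma> x - r x *\<^sub>R \<gamma> k"
  have "?\<eta> x + r x *\<^sub>R ?\<eta> k \<in> span (range ?\<eta>)"
    by (intro span_add span_scale span_base rangeI)
  then show "\<gamma> x \<in> span (range ?\<eta>)" using assms(2) by simp
qed

lemma dvec_eq:
  fixes \<gamma> :: "'v::finite \<Rightarrow> 'a::euclidean_space"
  assumes "independent_family \<gamma>" "\<alpha> = (\<Sum>y\<in>UNIV. of_int (c y) *\<^sub>R \<gamma> y)"
  shows "dvec \<gamma> \<alpha> x = \<bar>c x\<bar>"
proof -
  have "(THE c :: 'v \<Rightarrow> int. \<alpha> = (\<Sum>y\<in>UNIV. of_int (c y) *\<^sub>R \<gamma> y)) = c"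
  proof (rule the_equality[where P = "\<lambda>c. \<alpha> = (\<Sum>y\<in>UNIV. of_int (c y) *\<^sub>R \<gamma> y)", OF assms(2)])
    fix c' :: "'v \<Rightarrow> int" assume "\<alpha> = (\<Sum>y\<in>UNIV. of_int (c' y) *\<^sub>R \<gamma> y)"
    then have "(\<Sum>y\<in>UNIV. (of_int (c' y) - of_int (c y)) *\<^sub>R \<gamma> y) = 0"
      using assms(2) by (simp add: scaleR_left_diff_distrib sum_subtractf)
    from independent_familyD[OF assms(1) this] show "c' = c" by auto
  qed
  then show ?thesis by (simp add: dvec_def)
qed

section \<open>Coordinates for the roots of type A\<close>

lemma sum_of_bool_diff:
  fixes c :: "nat \<Rightarrow> real"
  assumes "a \<le> n" "b \<le> n"
  shows "(\<Sum>i\<le>n. c i * (of_bool (i = a) - of_bool (i = b))) = c a - c b"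
  using assms by (simp add: algebra_simps sum_subtractf)

lemma sum_simple_coordinates:
  assumes "a < n" "b < n"
  shows "(\<Sum>i\<le>n. (of_bool (i = a) - of_bool (i = Suc a)) * (of_bool (i = b) - of_bool (i = Suc b)))
    = (of_int (cartan_matrix_A a b) :: real)"
  using assms sum_of_bool_diff[of b n "Suc b" "\<lambda>i. of_bool (i = a) - of_bool (i = Suc a)"]
  by (auto simp: cartan_matrix_A_def)

text \<open>
  An integer vector of squared length \<open>2\<close> has two entries \<open>\<plusminus>1\<close> and no others; as the entries add
  up to \<open>0\<close>, their signs differ. This identifies the roots of type \<open>A\<close>.
\<close>

lemma sum_squares_two:
  fixes z :: "'i \<Rightarrow> int"
  assumes "finite I" "(\<Sum>i\<in>I. z i * z i) = 2" "(\<Sum>i\<in>I. z i) = 0"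
  shows "\<exists>p\<in>I. \<exists>q\<in>I. p \<noteq> q \<and> (\<forall>i\<in>I. z i = of_bool (i = p) - of_bool (i = q))"
proof -
  have nonzero: "\<exists>i\<in>I. z i \<noteq> 0"
  proof (rule ccontr)
    assume "\<not> ?thesis"
    then have "(\<Sum>i\<in>I. z i * z i) = 0" by (intro sum.neutral) auto
    then show False using assms(2) by simp
  qed
  have "\<exists>p\<in>I. z p > 0"
    using nonzero assms(1,3) sum_nonneg_eq_0_iff[of I "\<lambda>i. - z i"]
    by (fastforce simp: sum_negf not_less)
  then obtain p where p: "p \<in> I" "z p > 0" by blast
  have "\<exists>q\<in>I. z q < 0"
    using nonzero assms(1,3) sum_nonneg_eq_0_iff[of I z] by (metis not_le)
  then obtain q where q: "q \<in> I" "z q < 0" by blast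
  have "p \<noteq> q" using p q by auto
  have "(\<Sum>i\<in>I. z i * z i) = z p * z p + (z q * z q + (\<Sum>i\<in>I - {p} - {q}. z i * z i))"
    using assms(1) p q \<open>p \<noteq> q\<close> by (simp add: sum.remove[of I p] sum.remove[of "I - {p}" q])
  moreover have "z p * z p \<ge> z p" "z q * z q \<ge> - z q"
    using p q mult_mono[of 1 "z p" "z p" "z p"] mult_mono[of 1 "- z q" "- z q" "- z q"] by auto
  moreover have rest: "(\<Sum>i\<in>I - {p} - {q}. z i * z i) \<ge> 0"
    by (intro sum_nonneg) auto
  ultimately have *: "z p = 1" "z q = -1" "(\<Sum>i\<in>I - {p} - {q}. z i * z i) = 0"
    using assms(2) p q by linarith+
  have "z i = 0" if "i \<in> I" "i \<noteq> p" "i \<noteq> q" for i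
    using *(3) assms(1) that by (subst (asm) sum_nonneg_eq_0_iff) auto
  then show ?thesis using * p q \<open>p \<noteq> q\<close>
    by (intro bexI[of _ p] bexI[of _ q]) auto
qed

text \<open>
  \<open>D i v\<close> is the coordinate of \<open>v\<close> at \<open>\<epsilon>\<^sub>i\<close> when \<open>V\<close> is identified with the hyperplane of vectors
  with coordinate sum \<open>0\<close> in \<open>\<real>\<^sup>n\<^sup>+\<^sup>1\<close>, and \<open>\<delta> m = \<epsilon>\<^sub>m - \<epsilon>\<^sub>m\<^sub>+\<^sub>1\<close>. Working with the coordinate
  functionals keeps all vectors inside \<open>V\<close>.
\<close>

locale type_A_coordinates =
  fixes \<Phi> :: "'a::euclidean_space set" and n :: nat
    and \<delta> :: "nat \<Rightarrow> 'a" and D :: "nat \<Rightarrow> 'a \<Rightarrow> real"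
  assumes linear_D: "linear (D i)"
    and simple_root: "m < n \<Longrightarrow> \<delta> m \<in> \<Phi>"
    and inj_simple: "inj_on \<delta> {..<n}"
    and independent_simple: "independent (\<delta> ` {..<n})"
    and span_simple: "span (\<delta> ` {..<n}) = UNIV"
    and D_simple: "m < n \<Longrightarrow> D i (\<delta> m) = of_bool (i = m) - of_bool (i = Suc m)"
    and inner_D: "v \<bullet> w = (\<Sum>i\<le>n. D i v * D i w)"
    and root_form: "v \<in> \<Phi> \<Longrightarrow> \<exists>p q. p \<le> n \<and> q \<le> n \<and> p \<noteq> q \<and>
      (\<forall>i\<le>n. D i v = of_bool (i = p) - of_bool (i = q))"
    and reflection_root: "v \<in> \<Phi> \<Longrightarrow> w \<in> \<Phi> \<Longrightarrow> reflection v w \<in> \<Phi>"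
    and norm_root: "v \<in> \<Phi> \<Longrightarrow> v \<bullet> v = 2"
begin

lemma minus_root: "v \<in> \<Phi> \<Longrightarrow> - v \<in> \<Phi>"
  using reflection_root[of v v] norm_root[of v] by (simp add: reflection_def scaleR_2)

lemma sign_root: "v \<in> \<Phi> \<Longrightarrow> s = 1 \<or> s = -1 \<Longrightarrow> s *\<^sub>R v \<in> \<Phi>"
  using minus_root by auto

lemma linear_D_comb: "linear (\<lambda>v. \<Sum>i\<le>n. c i * D i v)"
  by (rule linearI)
    (simp_all add: linear_add[OF linear_D] linear_scale[OF linear_D] sum.distrib
      algebra_simps sum_distrib_left)

text \<open>
  The functional with weight \<open>h i\<close> at the \<open>i\<close>-th coordinate has the value \<open>h m - h (m + 1)\<close> at the
  \<open>m\<close>-th simple root, so weights for \<open>f\<close> are found by summation along the Dynkin diagram.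
\<close>

lemma functional_D:
  fixes f :: "'a \<Rightarrow> real"
  assumes "linear f"
  shows "f v = (\<Sum>i\<le>n. - (\<Sum>m<i. f (\<delta> m)) * D i v)"
proof -
  let ?g = "\<lambda>v. \<Sum>i\<le>n. - (\<Sum>m<i. f (\<delta> m)) * D i v"
  have lin: "linear ?g"
    by (rule linear_D_comb)
  show ?thesis
  proof (rule linear_eq_on_span[OF assms lin, of "\<delta> ` {..<n}"])
    fix w assume "w \<in> \<delta> ` {..<n}"
    then obtain m where m: "m < n" "w = \<delta> m" by auto
    have "?g w = (\<Sum>i\<le>n. (if i = m then - (\<Sum>m<i. f (\<delta> m)) else 0)
        - (if i = Suc m then - (\<Sum>m<i. f (\<delta> m)) else 0))"
      using m by (intro sum.cong) (auto simp: D_simple)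
    also have "\<dots> = f w" using m by (simp add: sum_subtractf)
    finally show "f w = ?g w" by simp
  qed (simp add: span_simple)
qed

text \<open>
  Regard the roots \<open>\<gamma> x\<close> as edges of a graph on the points \<open>0, \<dots>, n\<close> and write
  \<open>f v = \<Sum> h i D i v\<close>. The weights \<open>h\<close> agree at the two ends of each edge other than \<open>k\<close>. Hence if
  \<open>h\<close> took a value different from the two values at the ends of edge \<open>k\<close>, then the set of points
  with this value would be a union of components of the graph, and the sum of the coordinates
  over it would be a nonzero functional that vanishes on the spanning set of all edges. So \<open>h\<close>
  has just two values, and \<open>f \<alpha>\<close> is a difference of two of them. This is the unimodularity of
  the root system of type \<open>A\<close>.
\<close>

lemma functional_values:
  fixes f :: "'a \<Rightarrow> real" and \<gamma> :: "'v \<Rightarrow> 'a"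
  assumes "linear f" "range \<gamma> \<subseteq> \<Phi>" "span (range \<gamma>) = UNIV"
    and zero: "\<And>x. x \<noteq> k \<Longrightarrow> f (\<gamma> x) = 0"
    and "\<alpha> \<in> \<Phi>"
  shows "f \<alpha> = 0 \<or> \<bar>f \<alpha>\<bar> = \<bar>f (\<gamma> k)\<bar>"
proof -
  define h where "h i = - (\<Sum>m<i. f (\<delta> m))" for i
  have f_root: "f v = h p - h q"
    if "p \<le> n" "q \<le> n" "\<forall>i\<le>n. D i v = of_bool (i = p) - of_bool (i = q)" for v p q
  proof -
    have "f v = (\<Sum>i\<le>n. h i * (of_bool (i = p) - of_bool (i = q)))"
      unfolding functional_D[OF assms(1), of v] h_def using that(3) by (intro sum.cong) auto
    then show ?thesis using sum_of_bool_diff[of p n q h] that by simp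
  qed
  have in_roots: "\<gamma> x \<in> \<Phi>" for x using assms(2) by auto
  obtain p q where pq: "p \<le> n" "q \<le> n"
      "\<forall>i\<le>n. D i (\<gamma> k) = of_bool (i = p) - of_bool (i = q)"
    using root_form[OF in_roots] by metis
  have two: "h j = h p \<or> h j = h q" if j: "j \<le> n" for j
  proof (rule ccontr)
    assume neither: "\<not> ?thesis"
    \<comment> \<open>the indicator function of the set of points with the third value\<close>
    define I where "I i = (of_bool (h i = h j) :: real)" for i
    define u where "u v = (\<Sum>i\<le>n. I i * D i v)" for v
    have lin: "linear u"
      unfolding u_def by (rule linear_D_comb)
    have "u (\<gamma> x) = 0" for x
    proof -
      obtain a b where ab: "a \<le> n" "b \<le> n"
          "\<forall>i\<le>n. D i (\<gamma> x) = of_bool (i = a) - of_bool (i = b)"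
        using root_form[OF in_roots] by metis
      have u: "u (\<gamma> x) = I a - I b"
        unfolding u_def using ab sum_of_bool_diff[of a n b I] by simp
      show ?thesis
      proof (cases "x = k")
        case True
        have "u (\<gamma> k) = I p - I q"
          unfolding u_def using pq sum_of_bool_diff[of p n q I] by simp
        then show ?thesis using True neither by (auto simp: I_def)
      next
        case False
        then have "h a = h b" using f_root[OF ab] zero[of x] by simp
        then show ?thesis using u by (simp add: I_def)
      qed
    qed
    then have u0: "u v = 0" for v
      using linear_eq_0_on_span[OF lin, of "range \<gamma>" v] assms(3) by auto
    have step: "I m = I (Suc m)" if "m < n" for m
    proof -
      have "u (\<delta> m) = I m - I (Suc m)"
        unfolding u_def using that sum_of_bool_diff[of m n "Suc m" I] by (simp add: D_simple)
      then show ?thesis using u0 by simp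
    qed
    have const: "I m = I 0" if "m \<le> n" for m
      using that by (induction m) (auto simp flip: step)
    have "I p = I j" using const[OF j] const[OF pq(1)] by simp
    then show False using neither by (auto simp: I_def split: if_splits)
  qed
  obtain a b where ab: "a \<le> n" "b \<le> n"
      "\<forall>i\<le>n. D i \<alpha> = of_bool (i = a) - of_bool (i = b)"
    using root_form[OF assms(5)] by metis
  show ?thesis
    using two[OF ab(1)] two[OF ab(2)] f_root[OF ab] f_root[OF pq] by auto
qed

text \<open>
  Orthogonal roots \<open>\<epsilon>\<^sub>a - \<epsilon>\<^sub>b\<close> and \<open>\<epsilon>\<^sub>c - \<epsilon>\<^sub>d\<close> have disjoint supports, while roots that are not
  orthogonal share a point. The two points of \<open>z\<close> cannot meet three disjoint supports. (In type
  \<open>D\<^sub>4\<close> the three leaves and the centre of the Dynkin diagram do form a claw.)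
\<close>

lemma no_claw:
  assumes "u \<in> \<Phi>" "v \<in> \<Phi>" "w \<in> \<Phi>" "z \<in> \<Phi>"
    and "u \<bullet> v = 0" "u \<bullet> w = 0" "v \<bullet> w = 0"
    and "z \<bullet> u \<noteq> 0" "z \<bullet> v \<noteq> 0" "z \<bullet> w \<noteq> 0"
  shows False
proof -
  define ends where "ends v a b \<longleftrightarrow> a \<le> n \<and> b \<le> n \<and> a \<noteq> b \<and>
      (\<forall>i\<le>n. D i v = of_bool (i = a) - of_bool (i = b))" for v a b
  have inner: "v \<bullet> w = of_bool (a = c) - of_bool (a = d) - of_bool (b = c) + of_bool (b = d)"
    if "ends v a b" "ends w c d" for v w a b c d
  proof -
    have "v \<bullet> w = (\<Sum>i\<le>n. (of_bool (i = a) - of_bool (i = b)) * (of_bool (i = c) - of_bool (i = d)))"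
      unfolding inner_D using that by (intro sum.cong) (auto simp: ends_def)
    also have "\<dots> = of_bool (a = c) - of_bool (a = d) - of_bool (b = c) + of_bool (b = d)"
      using that by (simp add: ends_def algebra_simps sum.distrib sum_subtractf)
    finally show ?thesis .
  qed
  have "\<exists>a b. ends v a b" if "v \<in> \<Phi>" for v
    using root_form[OF that] by (auto simp: ends_def)
  then obtain a b where e: "\<And>v. v \<in> \<Phi> \<Longrightarrow> ends v (a v) (b v)" by metis
  have ne: "a v \<noteq> b v" if "v \<in> \<Phi>" for v using e[OF that] by (simp add: ends_def)
  have disjoint: "a v \<noteq> a w \<and> a v \<noteq> b w \<and> b v \<noteq> a w \<and> b v \<noteq> b w"
    if "v \<bullet> w = 0" "v \<in> \<Phi>" "w \<in> \<Phi>" for v w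
    using inner[OF e e, OF that(2,3)] ne[OF that(2)] ne[OF that(3)] that(1)
    by (auto simp: of_bool_def split: if_splits)
  have meet: "a v = a w \<or> a v = b w \<or> b v = a w \<or> b v = b w"
    if "v \<bullet> w \<noteq> 0" "v \<in> \<Phi>" "w \<in> \<Phi>" for v w
    using inner[OF e e, OF that(2,3)] that(1) by (auto simp: of_bool_def split: if_splits)
  show False
    using disjoint[OF assms(5,1,2)] disjoint[OF assms(6,1,3)] disjoint[OF assms(7,2,3)]
      meet[OF assms(8,4,1)] meet[OF assms(9,4,2)] meet[OF assms(10,4,3)] by metis
qed

text \<open>
  Suppose that the four roots form a square without diagonals and that three sides are \<open>-1\<close>. If
  the fourth side is \<open>-1\<close> too, then the sum of the roots has squared length \<open>8 - 8 = 0\<close>. If it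
  is \<open>1\<close>, then \<open>u\<close>, \<open>v\<close> and the root \<open>w + v + k\<close> form a claw with centre \<open>k\<close>, so that
  this case does not occur in type \<open>A\<close>.
\<close>

lemma square_dependent:
  assumes roots: "u \<in> \<Phi>" "k \<in> \<Phi>" "v \<in> \<Phi>" "w \<in> \<Phi>"
    and "u \<bullet> k = -1" "k \<bullet> v = -1" "v \<bullet> w = -1" "u \<bullet> v = 0" "k \<bullet> w = 0"
    and "u \<bullet> w = 1 \<or> u \<bullet> w = -1"
  shows "u + k + v + w = 0"
proof (cases "u \<bullet> w = 1")
  case True
  note inner = assms(5-9) True norm_root[OF roots(2)] norm_root[OF roots(3)]
  have inner': "k \<bullet> u = -1" "v \<bullet> k = -1" "w \<bullet> v = -1" "w \<bullet> k = 0"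
    using inner by (simp_all add: inner_commute)
  have "reflection v w = w + v"
    using inner inner' by (simp add: reflection_def)
  then have "w + v \<in> \<Phi>" using reflection_root[OF roots(3,4)] by simp
  moreover have "reflection k (w + v) = w + v + k"
    using inner inner' by (simp add: reflection_def inner_simps)
  ultimately have t: "w + v + k \<in> \<Phi>" using reflection_root[OF roots(2)] by metis
  have "u \<bullet> (w + v + k) = 0" "v \<bullet> (w + v + k) = 0" "k \<bullet> (w + v + k) \<noteq> 0"
      "k \<bullet> u \<noteq> 0" "k \<bullet> v \<noteq> 0"
    using inner inner' by (simp_all add: inner_simps)
  then show ?thesis using no_claw[OF roots(1,3) t roots(2)] assms(8) by blast
next
  case False
  then have "u \<bullet> w = -1" using assms(10) by simp
  then have "(u + k + v + w) \<bullet> (u + k + v + w) = 0"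
    using assms(5-9) norm_root[OF roots(1)] norm_root[OF roots(2)] norm_root[OF roots(3)]
      norm_root[OF roots(4)]
    by (simp add: inner_simps inner_commute)
  then show ?thesis by simp
qed

end

text \<open>
  The functionals \<open>D i\<close> are prescribed on the simple roots, where the inner products given by the
  Cartan matrix agree with those of the coordinate vectors. A root is an integer combination of
  simple roots, has squared length \<open>2\<close> and coordinate sum \<open>0\<close>, which determines its form.
\<close>

lemma type_A_coordinates_exist:
  fixes \<Phi> :: "'a::euclidean_space set"
  assumes "root_system_A n \<Phi>" and norm: "\<forall>\<beta>\<in>\<Phi>. \<beta> \<bullet> \<beta> = 2"
  obtains \<delta> D where "type_A_coordinates \<Phi> n \<delta> D"
proof -
  obtain \<Delta> e where base: "root_base \<Phi> \<Delta>" and e: "bij_betw e \<Delta> {..<n}"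
    and cartan: "\<forall>\<alpha>\<in>\<Delta>. \<forall>\<beta>\<in>\<Delta>.
        2 * (\<alpha> \<bullet> \<beta>) / (\<beta> \<bullet> \<beta>) = of_int (cartan_matrix_A (e \<alpha>) (e \<beta>))"
    using assms(1) by (auto simp: root_system_A_def)
  have \<Delta>: "\<Delta> \<subseteq> \<Phi>" "independent \<Delta>" "span \<Delta> = UNIV"
    and sign: "\<And>\<alpha>. \<alpha> \<in> \<Phi> \<Longrightarrow> nonneg_int_comb \<Delta> \<alpha> \<or> nonneg_int_comb \<Delta> (- \<alpha>)"
    using base by (auto simp: root_base_def)
  have inner_\<Delta>: "\<alpha> \<bullet> \<beta> = of_int (cartan_matrix_A (e \<alpha>) (e \<beta>))" if "\<alpha> \<in> \<Delta>" "\<beta> \<in> \<Delta>" for \<alpha> \<beta>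
  proof -
    have "\<beta> \<bullet> \<beta> = 2" using that norm \<Delta>(1) by auto
    then show ?thesis using cartan that by fastforce
  qed
  have e_less: "e \<alpha> < n" if "\<alpha> \<in> \<Delta>" for \<alpha> using e that by (auto simp: bij_betw_def)
  have "\<exists>g. linear g \<and> (\<forall>\<alpha>\<in>\<Delta>. g \<alpha> = (of_bool (i = e \<alpha>) - of_bool (i = Suc (e \<alpha>)) :: real))"
    for i by (rule linear_independent_extend[OF \<Delta>(2)])
  then obtain D where lin: "\<And>i. linear (D i)" and D: "\<And>i \<alpha>. \<alpha> \<in> \<Delta> \<Longrightarrow>
      D i \<alpha> = (of_bool (i = e \<alpha>) - of_bool (i = Suc (e \<alpha>)) :: real)"
    by metis
  define \<delta> where "\<delta> = inv_into \<Delta> e"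
  have \<delta>: "bij_betw \<delta> {..<n} \<Delta>" unfolding \<delta>_def by (rule bij_betw_inv_into[OF e])
  have e\<delta>: "e (\<delta> m) = m" if "m < n" for m
    unfolding \<delta>_def using e that by (simp add: bij_betw_inv_into_right)
  have \<delta>_in: "\<delta> m \<in> \<Delta>" if "m < n" for m using \<delta> that by (auto simp: bij_betw_def)
  have inner_D: "v \<bullet> w = (\<Sum>i\<le>n. D i v * D i w)" for v w
  proof (rule bilinear_eq[of inner "\<lambda>v w. \<Sum>i\<le>n. D i v * D i w" UNIV \<Delta> UNIV \<Delta>])
    show "bilinear (inner :: 'a \<Rightarrow> 'a \<Rightarrow> real)"
      by (auto simp: bilinear_def intro!: linearI simp: inner_simps)
    show "bilinear (\<lambda>v w. \<Sum>i\<le>n. D i v * D i w)"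
      by (auto simp: bilinear_def linear_add[OF lin] linear_scale[OF lin] sum.distrib
          algebra_simps sum_distrib_left intro!: linearI)
    show "\<alpha> \<bullet> \<beta> = (\<Sum>i\<le>n. D i \<alpha> * D i \<beta>)" if "\<alpha> \<in> \<Delta>" "\<beta> \<in> \<Delta>" for \<alpha> \<beta>
      using that by (simp add: inner_\<Delta> D sum_simple_coordinates e_less)
  qed (use \<Delta>(3) in auto)
  have sum_D: "(\<Sum>i\<le>n. D i v) = 0" for v
  proof (rule linear_eq_0_on_span[of "\<lambda>v. \<Sum>i\<le>n. D i v" \<Delta>])
    show "linear (\<lambda>v. \<Sum>i\<le>n. D i v)"
      by (intro linear_compose_sum ballI lin)
    show "(\<Sum>i\<le>n. D i \<alpha>) = 0" if "\<alpha> \<in> \<Delta>" for \<alpha>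
      using that sum_of_bool_diff[of "e \<alpha>" n "Suc (e \<alpha>)" "\<lambda>_. 1"] e_less[OF that] by (simp add: D)
  qed (use \<Delta>(3) in auto)
  have comb: "D i v \<in> \<int>" if comb: "nonneg_int_comb \<Delta> v" for i v
  proof -
    obtain c :: "'a \<Rightarrow> nat" where v: "v = (\<Sum>\<alpha>\<in>\<Delta>. of_nat (c \<alpha>) *\<^sub>R \<alpha>)"
      using comb by (auto simp: nonneg_int_comb_def)
    have "D i v = (\<Sum>\<alpha>\<in>\<Delta>. of_nat (c \<alpha>) * D i \<alpha>)"
      unfolding v by (simp add: linear_sum[OF lin] linear_scale[OF lin])
    then show ?thesis by (auto simp: D intro!: Ints_sum Ints_mult Ints_diff)
  qed
  have D_int: "D i v \<in> \<int>" if "v \<in> \<Phi>" for i v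
    using sign[OF that] comb[of v i] comb[of "- v" i]
    by (auto simp: linear_neg[OF lin] minus_in_Ints_iff)
  have form: "\<exists>p q. p \<le> n \<and> q \<le> n \<and> p \<noteq> q \<and> (\<forall>i\<le>n. D i v = of_bool (i = p) - of_bool (i = q))"
    if v: "v \<in> \<Phi>" for v
  proof -
    have "\<exists>z. D i v = of_int z" for i using D_int[OF v, of i] by (auto elim: Ints_cases)
    then obtain z where z: "\<And>i. D i v = of_int (z i)" by metis
    have "real_of_int (\<Sum>i\<le>n. z i * z i) = 2" "real_of_int (\<Sum>i\<le>n. z i) = 0"
      using inner_D[of v v] sum_D[of v] norm v by (simp_all add: z)
    then have "(\<Sum>i\<le>n. z i * z i) = 2" "(\<Sum>i\<le>n. z i) = 0" by linarith+
    then obtain p q where "p \<le> n" "q \<le> n" "p \<noteq> q"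
        "\<forall>i\<le>n. z i = of_bool (i = p) - of_bool (i = q)"
      using sum_squares_two[of "{..n}" z] by auto
    then show ?thesis by (intro exI[of _ p] exI[of _ q]) (auto simp: z)
  qed
  have refl: "reflection v w \<in> \<Phi>" if "v \<in> \<Phi>" "w \<in> \<Phi>" for v w
  proof -
    have "root_system \<Phi>" using assms(1) by (simp add: root_system_A_def)
    then have "w - (2 * (w \<bullet> v) / (v \<bullet> v)) *\<^sub>R v \<in> \<Phi>"
      using that by (simp add: root_system_def)
    then show ?thesis using norm that by (simp add: reflection_def)
  qed
  have "type_A_coordinates \<Phi> n \<delta> D"
  proof (rule type_A_coordinates.intro)
    show "inj_on \<delta> {..<n}" using \<delta> by (simp add: bij_betw_def)
    show "independent (\<delta> ` {..<n})" "span (\<delta> ` {..<n}) = UNIV"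
      using \<delta> \<Delta> by (simp_all add: bij_betw_def)
    show "D i (\<delta> m) = of_bool (i = m) - of_bool (i = Suc m)" if "m < n" for i m
      using that by (simp add: D \<delta>_in e\<delta>)
  qed (use lin \<delta>_in \<Delta>(1) inner_D form refl norm in auto)
  then show ?thesis by (rule that)
qed

section \<open>Mutation of exchange matrices realised by roots\<close>

lemma skew_symmetric_iff: "skew_symmetric B \<longleftrightarrow> (\<forall>x y. B $ x $ y = - B $ y $ x)"
proof -
  have "transpose B = - B \<longleftrightarrow> (\<forall>x y. B $ y $ x = - B $ x $ y)"
    by (simp only: vec_eq_iff transpose_def vec_lambda_beta vector_uminus_component)
  then show ?thesis unfolding skew_symmetric_def by blast
qed

lemma skew_symmetric_entry:
  assumes "skew_symmetric B"
  shows "B $ x $ y = - B $ y $ x"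
  using assms unfolding skew_symmetric_iff by blast

text \<open>
  \<open>u\<close> and \<open>v\<close> are the entries along a path through \<open>k\<close>. The value is the number of arrows that
  mutation composes from this path, counted negatively for a path in the backward direction.
\<close>

definition signed_product :: "int \<Rightarrow> int \<Rightarrow> int" where
  "signed_product u v =
     (if u > 0 \<and> v > 0 then u * v else if u < 0 \<and> v < 0 then - (u * v) else 0)"

lemma signed_product_minus: "signed_product (- u) (- v) = - signed_product u v"
  by (simp add: signed_product_def)

lemma signed_product_commute: "signed_product u v = signed_product v u"
  by (simp add: signed_product_def mult.commute)

lemma signed_product_half: "(\<bar>u\<bar> * v + u * \<bar>v\<bar>) div 2 = signed_product u v"
proof -
  have "\<bar>u\<bar> * v + u * \<bar>v\<bar> = 2 * signed_product u v"
    by (auto simp: abs_if not_less signed_product_def)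
  then show ?thesis by simp
qed

lemma mutation_entry:
  "mutation k B $ x $ y = (if x = k \<or> y = k then - B $ x $ y
    else B $ x $ y + signed_product (B $ x $ k) (B $ k $ y))"
  by (simp add: mutation_def signed_product_half)

lemma skew_symmetric_mutation:
  assumes "skew_symmetric B"
  shows "skew_symmetric (mutation k B)"
proof -
  have "mutation k B $ x $ y = - mutation k B $ y $ x" for x y
    unfolding mutation_entry skew_symmetric_entry[OF assms, of y x]
      skew_symmetric_entry[OF assms, of y k] skew_symmetric_entry[OF assms, of k x]
      signed_product_minus signed_product_commute[of "B $ k $ y"]
    by auto
  then show ?thesis unfolding skew_symmetric_iff by blast
qed

lemma mutation_involution: "mutation k (mutation k B) = B"
  unfolding vec_eq_iff mutation_entry by (simp add: signed_product_minus)

text \<open>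
  Since \<open>B $ x $ y > 0\<close> forces \<open>x \<noteq> y\<close> in a skew-symmetric matrix, the condition speaks of three
  distinct vertices and of the noncyclic orientation of a triangle on them.
\<close>

definition triangles_cyclic :: "int ^ 'v ^ 'v \<Rightarrow> bool" where
  "triangles_cyclic B \<longleftrightarrow>
     (\<forall>x y z. B $ x $ y > 0 \<longrightarrow> B $ y $ z > 0 \<longrightarrow> \<not> B $ x $ z > 0)"

context type_A_coordinates
begin

text \<open>
  A companion basis without the requirement that it generate the root lattice over \<open>\<int>\<close>;
  independence is what excludes wrong configurations below.
\<close>

definition realises :: "('v \<Rightarrow> 'a) \<Rightarrow> int ^ 'v ^ 'v \<Rightarrow> bool" where
  "realises \<gamma> B \<longleftrightarrow> range \<gamma> \<subseteq> \<Phi> \<and> independent_family \<gamma> \<and>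
     (\<forall>x y. x \<noteq> y \<longrightarrow> \<bar>\<gamma> x \<bullet> \<gamma> y\<bar> = of_int \<bar>B $ x $ y\<bar>)"

text \<open>
  If \<open>\<bar>\<gamma> x \<bullet> \<gamma> y\<bar> \<ge> 2\<close>, then \<open>\<gamma> x \<mp> \<gamma> y\<close> has squared length at most \<open>2 - 4 + 2 = 0\<close>.
\<close>

lemma realises_entry:
  assumes "skew_symmetric B" "realises \<gamma> B"
  shows "\<bar>B $ x $ y\<bar> \<le> 1"
proof (cases "x = y")
  case True
  then show ?thesis using skew_symmetric_entry[OF assms(1), of x x] by simp
next
  case False
  show ?thesis
  proof (rule ccontr)
    assume "\<not> ?thesis"
    then have "\<bar>B $ x $ y\<bar> \<ge> 2" by simp
    then have ge: "\<bar>\<gamma> x \<bullet> \<gamma> y\<bar> \<ge> 2"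
      using assms(2) False by (simp add: realises_def)
    define s where "s = sgn (\<gamma> x \<bullet> \<gamma> y)"
    have s: "s * s = 1" "s * (\<gamma> x \<bullet> \<gamma> y) = \<bar>\<gamma> x \<bullet> \<gamma> y\<bar>"
      using ge by (auto simp: s_def sgn_if)
    have n: "\<gamma> x \<bullet> \<gamma> x = 2" "\<gamma> y \<bullet> \<gamma> y = 2"
      using assms(2) by (auto simp: realises_def intro!: norm_root)
    have "(\<gamma> x - s *\<^sub>R \<gamma> y) \<bullet> (\<gamma> x - s *\<^sub>R \<gamma> y)
        = \<gamma> x \<bullet> \<gamma> x - 2 * (s * (\<gamma> x \<bullet> \<gamma> y)) + (s * s) * (\<gamma> y \<bullet> \<gamma> y)"
      by (simp add: inner_simps inner_commute algebra_simps)
    also have "\<dots> \<le> 0" using s n ge by simp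
    finally have "\<gamma> x - s *\<^sub>R \<gamma> y = 0"
      using inner_gt_zero_iff[of "\<gamma> x - s *\<^sub>R \<gamma> y"] by linarith
    then show False
      using independent_family_four[of \<gamma> 1 x "- s" y 0 y 0 y] assms(2) False
      by (simp add: realises_def)
  qed
qed

lemma realises_inner:
  assumes "skew_symmetric B" "realises \<gamma> B" "x \<noteq> y"
  shows "B $ x $ y = 0 \<Longrightarrow> \<gamma> x \<bullet> \<gamma> y = 0"
    and "B $ x $ y \<noteq> 0 \<Longrightarrow> \<gamma> x \<bullet> \<gamma> y = 1 \<or> \<gamma> x \<bullet> \<gamma> y = -1"
proof -
  have *: "\<bar>\<gamma> x \<bullet> \<gamma> y\<bar> = of_int \<bar>B $ x $ y\<bar>" using assms by (simp add: realises_def)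
  then show "B $ x $ y = 0 \<Longrightarrow> \<gamma> x \<bullet> \<gamma> y = 0" by simp
  show "\<gamma> x \<bullet> \<gamma> y = 1 \<or> \<gamma> x \<bullet> \<gamma> y = -1" if "B $ x $ y \<noteq> 0"
  proof -
    have "\<bar>B $ x $ y\<bar> = 1" using realises_entry[OF assms(1,2), of x y] that by linarith
    then show ?thesis using * by (auto simp: abs_if split: if_splits)
  qed
qed

text \<open>
  The product of the three inner products of a triangle is \<open>1\<close>: were it \<open>-1\<close>, then a suitable
  signed sum of the three roots would have squared length \<open>6 - 6 = 0\<close>, against independence.
\<close>

lemma realises_triangle:
  assumes "skew_symmetric B" "realises \<gamma> B"
    and "x \<noteq> k" "y \<noteq> k" "x \<noteq> y" "B $ x $ k \<noteq> 0" "B $ k $ y \<noteq> 0" "B $ x $ y \<noteq> 0"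
  shows "\<gamma> x \<bullet> \<gamma> y = (\<gamma> x \<bullet> \<gamma> k) * (\<gamma> k \<bullet> \<gamma> y)"
proof (rule ccontr)
  assume ne: "\<not> ?thesis"
  define a where "a = \<gamma> x \<bullet> \<gamma> k"
  define b where "b = \<gamma> k \<bullet> \<gamma> y"
  have a: "a = 1 \<or> a = -1" and b: "b = 1 \<or> b = -1"
    using realises_inner(2)[OF assms(1,2)] assms(3-) by (auto simp: a_def b_def)
  have xy: "\<gamma> x \<bullet> \<gamma> y = - (a * b)"
    using realises_inner(2)[OF assms(1,2,5,8)] ne a b by (auto simp: a_def b_def)
  have n: "\<gamma> v \<bullet> \<gamma> v = 2" for v
    using assms(2) by (auto simp: realises_def intro!: norm_root)
  let ?v = "\<gamma> k - a *\<^sub>R \<gamma> x - b *\<^sub>R \<gamma> y"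
  have "?v \<bullet> ?v = \<gamma> k \<bullet> \<gamma> k + a * a * (\<gamma> x \<bullet> \<gamma> x) + b * b * (\<gamma> y \<bullet> \<gamma> y)
      - 2 * a * (\<gamma> x \<bullet> \<gamma> k) - 2 * b * (\<gamma> k \<bullet> \<gamma> y) + 2 * a * b * (\<gamma> x \<bullet> \<gamma> y)"
    by (simp add: inner_simps inner_commute algebra_simps)
  also have "\<dots> = 0"
    unfolding n xy a_def[symmetric] b_def[symmetric] using a b by auto
  finally have "?v = 0" by simp
  then show False
    using independent_family_four[of \<gamma> 1 k "- a" x "- b" y 0 x] assms(2-4)
    by (simp add: realises_def)
qed

text \<open>
  Choosing the signs of \<open>\<gamma> u\<close>, \<open>\<gamma> v\<close> and \<open>\<gamma> w\<close> one after the other makes three sides of the square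
  equal to \<open>-1\<close>; then \<open>square_dependent\<close> yields a relation between independent roots.
\<close>

lemma realises_no_square:
  assumes "skew_symmetric B" "realises \<gamma> B"
    and dist: "u \<noteq> k" "v \<noteq> k" "w \<noteq> k" "u \<noteq> v" "u \<noteq> w" "v \<noteq> w"
    and ne: "B $ u $ k \<noteq> 0" "B $ k $ v \<noteq> 0" "B $ v $ w \<noteq> 0" "B $ u $ w \<noteq> 0"
    and zero: "B $ u $ v = 0" "B $ k $ w = 0"
  shows False
proof -
  note inn = realises_inner[OF assms(1,2)]
  define a where "a = - (\<gamma> u \<bullet> \<gamma> k)"
  define b where "b = - (\<gamma> k \<bullet> \<gamma> v)"
  define c where "c = - b * (\<gamma> v \<bullet> \<gamma> w)"
  have a: "a = 1 \<or> a = -1" using inn(2)[OF dist(1) ne(1)] by (auto simp: a_def)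
  have b: "b = 1 \<or> b = -1" using inn(2)[OF dist(2)[symmetric] ne(2)] by (auto simp: b_def)
  have c: "c = 1 \<or> c = -1" using inn(2)[OF dist(6) ne(3)] b by (auto simp: c_def)
  have vw: "\<gamma> v \<bullet> \<gamma> w = - b * c" using b by (auto simp: c_def)
  have roots: "\<gamma> z \<in> \<Phi>" for z using assms(2) by (auto simp: realises_def)
  have ac: "a * c = 1 \<or> a * c = -1" using a c by auto
  have "a *\<^sub>R \<gamma> u + \<gamma> k + b *\<^sub>R \<gamma> v + c *\<^sub>R \<gamma> w = 0"
  proof (rule square_dependent)
    show "a *\<^sub>R \<gamma> u \<in> \<Phi>" "\<gamma> k \<in> \<Phi>" "b *\<^sub>R \<gamma> v \<in> \<Phi>" "c *\<^sub>R \<gamma> w \<in> \<Phi>"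
      using sign_root roots a b c by auto
    show "(a *\<^sub>R \<gamma> u) \<bullet> \<gamma> k = -1" using a by (auto simp: a_def)
    show "\<gamma> k \<bullet> (b *\<^sub>R \<gamma> v) = -1" using b by (auto simp: b_def)
    show "(b *\<^sub>R \<gamma> v) \<bullet> (c *\<^sub>R \<gamma> w) = -1" using b c by (auto simp: vw)
    show "(a *\<^sub>R \<gamma> u) \<bullet> (b *\<^sub>R \<gamma> v) = 0" using inn(1)[OF dist(4) zero(1)] by simp
    show "\<gamma> k \<bullet> (c *\<^sub>R \<gamma> w) = 0" using inn(1)[OF dist(3)[symmetric] zero(2)] by simp
    show "(a *\<^sub>R \<gamma> u) \<bullet> (c *\<^sub>R \<gamma> w) = 1 \<or> (a *\<^sub>R \<gamma> u) \<bullet> (c *\<^sub>R \<gamma> w) = -1"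
      using inn(2)[OF dist(5) ne(4)] ac by (auto simp: mult.commute)
  qed
  then have "1 *\<^sub>R \<gamma> k + a *\<^sub>R \<gamma> u + b *\<^sub>R \<gamma> v + c *\<^sub>R \<gamma> w = 0" by (simp add: add.commute)
  then show False
    using independent_family_four[of \<gamma> 1 k a u b v c w] assms(2) dist by (simp add: realises_def)
qed

text \<open>
  Only the inner products of \<open>\<gamma>' x\<close> and \<open>\<gamma>' y\<close> for \<open>x \<rightarrow> k \<rightarrow> y\<close> are affected other than in sign.
  There \<open>b\<^sub>x\<^sub>y\<close> is \<open>0\<close> or \<open>-1\<close>, as the triangle would be noncyclic otherwise, and mutation
  exchanges these two cases up to sign. The inner product follows: it becomes \<open>\<plusminus>1\<close> if it was \<open>0\<close>, and
  it is cancelled by \<open>realises_triangle\<close> if it was \<open>\<plusminus>1\<close>.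
\<close>

lemma realises_mutation:
  assumes skew: "skew_symmetric B" and real: "realises \<gamma> B" and cyc: "triangles_cyclic B"
  shows "realises (mutate_inwardly (quiver B) k \<gamma>) (mutation k B)"
proof -
  define r where "r x = (if B $ x $ k > 0 then \<gamma> x \<bullet> \<gamma> k else 0)" for x
  let ?\<eta> = "\<lambda>x. \<gamma> x - r x *\<^sub>R \<gamma> k"
  have \<eta>: "mutate_inwardly (quiver B) k \<gamma> = ?\<eta>"
    by (auto simp: mutate_inwardly_def quiver_def reflection_def r_def)
  have roots: "\<gamma> x \<in> \<Phi>" for x using real by (auto simp: realises_def)
  have kk: "B $ k $ k = 0" using skew_symmetric_entry[OF skew, of k k] by simp
  then have rk: "r k = 0" by (simp add: r_def)
  note sk = skew_symmetric_entry[OF skew]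
  note inn = realises_inner[OF skew real]
  have gram: "?\<eta> x \<bullet> ?\<eta> y = \<gamma> x \<bullet> \<gamma> y - r y * (\<gamma> x \<bullet> \<gamma> k) - r x * (\<gamma> k \<bullet> \<gamma> y) + 2 * r x * r y"
    for x y
    using norm_root[OF roots[of k]] by (simp add: inner_simps inner_commute algebra_simps)
  have B_eq: "\<bar>\<gamma> x \<bullet> \<gamma> y\<bar> = of_int \<bar>B $ x $ y\<bar>" if "x \<noteq> y" for x y
    using real that by (simp add: realises_def)
  define good where "good x y \<longleftrightarrow> \<bar>?\<eta> x \<bullet> ?\<eta> y\<bar> = of_int \<bar>mutation k B $ x $ y\<bar>" for x y
  have good_sym: "good x y" if "good y x" for x y
    using that skew_symmetric_entry[OF skew_symmetric_mutation[OF skew], of k x y]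
    by (simp add: good_def inner_commute)
  have at_k: "good x k" if "x \<noteq> k" for x
  proof -
    have "?\<eta> x \<bullet> ?\<eta> k = \<gamma> x \<bullet> \<gamma> k - 2 * r x"
      unfolding gram using norm_root[OF roots[of k]] by (simp add: rk)
    then have "\<bar>?\<eta> x \<bullet> ?\<eta> k\<bar> = \<bar>\<gamma> x \<bullet> \<gamma> k\<bar>" by (simp add: r_def)
    then show ?thesis unfolding good_def using B_eq[OF that] by (simp add: mutation_entry signed_product_def)
  qed
  have mixed: "good x y"
    if d: "x \<noteq> k" "y \<noteq> k" "x \<noteq> y" and xk: "B $ x $ k > 0" and yk: "\<not> B $ y $ k > 0" for x y
  proof -
    have g: "?\<eta> x \<bullet> ?\<eta> y = \<gamma> x \<bullet> \<gamma> y - (\<gamma> x \<bullet> \<gamma> k) * (\<gamma> k \<bullet> \<gamma> y)"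
      unfolding gram using xk yk by (simp add: r_def)
    have x1: "B $ x $ k = 1" using realises_entry[OF skew real, of x k] xk by linarith
    show ?thesis
    proof (cases "B $ k $ y = 0")
      case True
      then show ?thesis
        unfolding good_def g using inn(1)[of k y] d B_eq[OF d(3)] by (simp add: mutation_entry signed_product_def)
    next
      case False
      then have y1: "B $ k $ y = 1"
        using realises_entry[OF skew real, of k y] yk sk[of k y] by linarith
      have b': "mutation k B $ x $ y = B $ x $ y + 1"
        using x1 y1 d by (simp add: mutation_entry signed_product_def)
      have "\<not> B $ x $ y > 0" using cyc xk y1 unfolding triangles_cyclic_def by (metis zero_less_one)
      then consider "B $ x $ y = 0" | "B $ x $ y = -1"
        using realises_entry[OF skew real, of x y] by linarith
      then show ?thesis
      proof cases
        case 1
        then show ?thesis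
          unfolding good_def g b'
          using inn(1)[OF d(3)] inn(2)[OF d(1)] inn(2)[OF d(2)[symmetric]] x1 y1 by auto
      next
        case 2
        then show ?thesis
          unfolding good_def g b'
          using realises_triangle[OF skew real d(1,2,3)] x1 y1 by simp
      qed
    qed
  qed
  have same: "good x y"
    if d: "x \<noteq> k" "y \<noteq> k" "x \<noteq> y" and iff: "B $ x $ k > 0 \<longleftrightarrow> B $ y $ k > 0" for x y
  proof -
    have "?\<eta> x \<bullet> ?\<eta> y = \<gamma> x \<bullet> \<gamma> y"
      unfolding gram using iff by (simp add: r_def inner_commute)
    moreover have "mutation k B $ x $ y = B $ x $ y"
      using d iff sk[of k y] by (auto simp: mutation_entry signed_product_def)
    ultimately show ?thesis unfolding good_def using B_eq[OF d(3)] by simp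
  qed
  have "good x y" if "x \<noteq> y" for x y
    using that at_k good_sym mixed same by metis
  moreover have "?\<eta> x \<in> \<Phi>" for x
    using roots reflection_root[OF roots[of k] roots[of x]] by (simp add: r_def reflection_def)
  moreover have "independent_family ?\<eta>"
    using real rk by (intro independent_family_transvection) (simp_all add: realises_def)
  ultimately show ?thesis unfolding \<eta> by (auto simp: realises_def good_def)
qed

text \<open>
  A noncyclic triangle of the mutated quiver that contains \<open>k\<close> comes from a noncyclic triangle, or
  from an entry of absolute value \<open>2\<close>. If it does not contain \<open>k\<close> and mutation leaves its entries
  alone, it was there before. Otherwise one of its edges joins \<open>u\<close> and \<open>v\<close> with
  \<open>u \<rightarrow> k \<rightarrow> v\<close>; the third vertex \<open>w\<close> then forms a noncyclic triangle with \<open>k\<close> and one of \<open>u\<close>, \<open>v\<close>,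
  or, if it is not adjacent to \<open>k\<close>, a square without diagonals with \<open>u\<close>, \<open>k\<close>, \<open>v\<close>.
\<close>

lemma triangles_cyclic_mutation:
  assumes skew: "skew_symmetric B" and real: "realises \<gamma> B" and cyc: "triangles_cyclic B"
  shows "triangles_cyclic (mutation k B)"
proof -
  let ?B = "mutation k B"
  note sk = skew_symmetric_entry[OF skew]
  note sk' = skew_symmetric_entry[OF skew_symmetric_mutation[OF skew, of k]]
  have small: "\<bar>B $ x $ y\<bar> \<le> 1" for x y by (rule realises_entry[OF skew real])
  have pos: "B $ x $ y = 1" if "B $ x $ y > 0" for x y using small[of x y] that by linarith
  have no: False if "B $ x $ y > 0" "B $ y $ z > 0" "B $ x $ z > 0" for x y z
    using cyc that by (auto simp: triangles_cyclic_def)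
  have path: False
    if d: "u \<noteq> k" "v \<noteq> k" "w \<noteq> k" and uk: "B $ u $ k > 0" and kv: "B $ k $ v > 0"
      and uv: "?B $ u $ v \<noteq> 0" and uw: "?B $ u $ w \<noteq> 0" and vw: "?B $ v $ w \<noteq> 0" for u v w
  proof -
    have "?B $ u $ v = B $ u $ v + 1" using d pos[OF uk] pos[OF kv] by (simp add: mutation_entry signed_product_def)
    then have uv0: "B $ u $ v = 0" using uv no[OF uk kv] small[of u v] by fastforce
    have ne: "u \<noteq> v" "u \<noteq> w" "v \<noteq> w"
      using uk kv sk[of v k] uw vw sk'[of w w] by auto
    have uw': "B $ w $ k \<ge> 0 \<Longrightarrow> B $ u $ w \<noteq> 0"
      using uw uk d sk[of k w] by (auto simp: mutation_entry signed_product_def split: if_splits)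
    have vw': "B $ w $ k \<le> 0 \<Longrightarrow> B $ v $ w \<noteq> 0"
      using vw kv d sk[of k w] sk[of v k] by (auto simp: mutation_entry signed_product_def split: if_splits)
    consider "B $ w $ k > 0" | "B $ w $ k = 0" | "B $ w $ k < 0" by linarith
    then show False
    proof cases
      case 1
      then have "B $ u $ w > 0 \<or> B $ w $ u > 0" using uw' sk[of u w] by auto
      then show False using no[OF _ 1 uk] no[OF _ uk 1] by blast
    next
      case 2
      then show False
        using realises_no_square[OF skew real d ne] uk kv uw' vw' uv0 sk[of k w] by auto
    next
      case 3
      then have kw: "B $ k $ w > 0" using sk[of k w] by simp
      have "B $ v $ w > 0 \<or> B $ w $ v > 0" using vw' 3 sk[of v w] by auto
      then show False using no[OF kv _ kw] no[OF kw _ kv] by blast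
    qed
  qed
  have unchanged: "?B $ u $ v = B $ u $ v"
    if "u \<noteq> k" "v \<noteq> k" "\<not> (B $ u $ k > 0 \<and> B $ k $ v > 0)" "\<not> (B $ v $ k > 0 \<and> B $ k $ u > 0)"
    for u v
    using that sk[of u k] sk[of v k] by (auto simp: mutation_entry signed_product_def)
  have False if xy: "?B $ x $ y > 0" and yz: "?B $ y $ z > 0" and xz: "?B $ x $ z > 0" for x y z
  proof -
    have ne: "x \<noteq> y" "y \<noteq> z" "x \<noteq> z"
      using xy yz xz sk'[of x x] sk'[of y y] sk'[of z z] by auto
    consider "x = k" | "y = k" | "z = k" | "x \<noteq> k" "y \<noteq> k" "z \<noteq> k" by blast
    then show False
    proof cases
      case 1
      then have "B $ y $ k > 0" "B $ z $ k > 0"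
        using xy xz sk[of y k] sk[of z k] by (simp_all add: mutation_entry signed_product_def)
      moreover from this have "B $ y $ z > 0"
        using unchanged[of y z] yz ne 1 sk[of k y] sk[of k z] by simp
      ultimately show False using no by blast
    next
      case 2
      then have zk: "B $ k $ x > 0" "B $ z $ k > 0"
        using xy yz sk[of k x] sk[of z k] by (simp_all add: mutation_entry signed_product_def)
      then have "?B $ x $ z = B $ x $ z - 1"
        using pos[OF zk(1)] pos[OF zk(2)] sk[of x k] sk[of k z] ne 2 by (simp add: mutation_entry signed_product_def)
      then show False using xz small[of x z] by linarith
    next
      case 3
      then have "B $ k $ x > 0" "B $ k $ y > 0"
        using xz yz sk[of k x] sk[of k y] by (simp_all add: mutation_entry signed_product_def)
      moreover from this have "B $ x $ y > 0"
        using unchanged[of x y] xy ne 3 sk[of x k] sk[of y k] by simp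
      ultimately show False using no by blast
    next
      case 4
      have nz: "?B $ x $ y \<noteq> 0" "?B $ y $ z \<noteq> 0" "?B $ x $ z \<noteq> 0"
          "?B $ y $ x \<noteq> 0" "?B $ z $ y \<noteq> 0" "?B $ z $ x \<noteq> 0"
        using xy yz xz sk'[of y x] sk'[of z y] sk'[of z x] by auto
      have "?B $ x $ y = B $ x $ y" "?B $ y $ z = B $ y $ z" "?B $ x $ z = B $ x $ z"
        using unchanged[of x y] unchanged[of y z] unchanged[of x z] 4 nz
          path[of x y z] path[of y x z] path[of y z x] path[of z y x] path[of x z y] path[of z x y]
        by blast+
      then show False using no xy yz xz by metis
    qed
  qed
  then show ?thesis by (auto simp: triangles_cyclic_def)
qed

end

section \<open>Coefficients of a root under inward mutation\<close>

text \<open>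
  If \<open>K = 0\<close>, then the bounds on \<open>X x \<plusminus> X y\<close> allow only one nonzero \<open>X x\<close>; if \<open>K = \<plusminus>1\<close>, then the
  bound on \<open>K + X x\<close> makes every nonzero \<open>X x\<close> opposite in sign to \<open>K\<close>.
\<close>

lemma abs_sum_signs:
  fixes X :: "'i \<Rightarrow> int"
  assumes "finite N" and K: "\<bar>K\<bar> \<le> 1"
    and one: "\<And>x. x \<in> N \<Longrightarrow> \<bar>X x\<bar> \<le> 1 \<and> \<bar>K + X x\<bar> \<le> 1"
    and two: "\<And>x y. x \<in> N \<Longrightarrow> y \<in> N \<Longrightarrow> x \<noteq> y \<Longrightarrow>
      \<bar>K + (X x + X y)\<bar> \<le> 1 \<and> \<bar>X x - X y\<bar> \<le> 1"
  shows "\<bar>K + (\<Sum>x\<in>N. X x)\<bar> = \<bar>- \<bar>K\<bar> + (\<Sum>x\<in>N. \<bar>X x\<bar>)\<bar>"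
proof -
  consider "K = 0" | "K = 1" | "K = -1" using K by linarith
  then show ?thesis
  proof cases
    case 1
    show ?thesis
    proof (cases "\<exists>x\<in>N. X x \<noteq> 0")
      case True
      then obtain x where x: "x \<in> N" "X x \<noteq> 0" by blast
      have "X y = 0" if "y \<in> N - {x}" for y
        using one[OF x(1)] two[OF x(1), of y] x(2) that 1 by fastforce
      then have "(\<Sum>y\<in>N - {x}. X y) = 0" "(\<Sum>y\<in>N - {x}. \<bar>X y\<bar>) = 0"
        by (simp_all add: sum.neutral)
      then show ?thesis
        using assms(1) x(1) 1 sum.remove[of N x X] sum.remove[of N x "\<lambda>y. \<bar>X y\<bar>"] by simp
    next
      case False
      then have "(\<Sum>y\<in>N. X y) = 0" "(\<Sum>y\<in>N. \<bar>X y\<bar>) = 0"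
        by (simp_all add: sum.neutral)
      then show ?thesis using 1 by simp
    qed
  next
    case 2
    have "(\<Sum>x\<in>N. X x) = (\<Sum>x\<in>N. - \<bar>X x\<bar>)"
      using one 2 by (intro sum.cong refl) fastforce
    then show ?thesis using 2 by (simp add: sum_negf)
  next
    case 3
    have "(\<Sum>x\<in>N. X x) = (\<Sum>x\<in>N. \<bar>X x\<bar>)"
      using one 3 by (intro sum.cong refl) fastforce
    then show ?thesis using 3 by simp
  qed
qed

lemma int_basis_expansion:
  fixes \<gamma> :: "'v::finite \<Rightarrow> 'a::euclidean_space"
  assumes "int_basis \<gamma> S" "v \<in> S"
  obtains c :: "'v \<Rightarrow> int" where "v = (\<Sum>y\<in>UNIV. of_int (c y) *\<^sub>R \<gamma> y)"
proof -
  interpret int_scale: module int_scale by (rule module_int_scale)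
  have "v \<in> int_scale.span (range \<gamma>)"
    using assms int_scale.span_base[of v S] by (simp add: int_basis_def)
  then obtain u where "v = (\<Sum>w\<in>range \<gamma>. int_scale (u w) w)"
    by (auto simp: int_scale.span_finite)
  also have "\<dots> = (\<Sum>y\<in>UNIV. of_int (u (\<gamma> y)) *\<^sub>R \<gamma> y)"
    using assms(1) by (simp add: int_basis_def sum.reindex int_scale_def)
  finally show ?thesis by (rule that)
qed

text \<open>
  The quadratic form of \<open>A\<close> is the squared length of the corresponding combination of the \<open>\<gamma> x\<close>.
\<close>

lemma independent_family_gram:
  fixes \<gamma> :: "'v::finite \<Rightarrow> 'a::euclidean_space"
  assumes gram: "\<And>x y. of_int (A $ x $ y) = \<gamma> x \<bullet> \<gamma> y" and pos: "positive_definite A"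
  shows "independent_family \<gamma>"
  unfolding independent_family_def
proof (intro allI impI)
  fix c x assume 0: "(\<Sum>x\<in>UNIV. c x *\<^sub>R \<gamma> x) = 0"
  define v where "v = vec_lambda c"
  have "v \<bullet> ((\<chi> x y. of_int (A $ x $ y)) *v v)
      = (\<Sum>x\<in>UNIV. c x *\<^sub>R \<gamma> x) \<bullet> (\<Sum>x\<in>UNIV. c x *\<^sub>R \<gamma> x)"
    by (simp add: v_def inner_vec_def matrix_vector_mult_def gram inner_sum_left inner_sum_right
        sum_distrib_left algebra_simps) (simp add: inner_commute)
  then have "v = 0" using 0 pos unfolding positive_definite_def by (metis inner_zero_left less_irrefl)
  then show "c x = 0" by (simp add: v_def vec_eq_iff)
qed

context type_A_coordinates
begin

text \<open>
  The simple roots realise the matrix, and a path has no triangles.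
\<close>

lemma realises_linear_quiver:
  fixes B :: "int ^ 'v ^ 'v"
  assumes skew: "skew_symmetric B" and e: "bij_betw e (UNIV :: 'v set) {..<n}"
    and cartan: "\<And>x y. cartan_counterpart B $ x $ y = cartan_matrix_A (e x) (e y)"
  shows "realises (\<lambda>x. \<delta> (e x)) B" and "triangles_cyclic B"
proof -
  have less: "e x < n" for x using e by (auto simp: bij_betw_def)
  have entry: "- \<bar>B $ x $ y\<bar> = cartan_matrix_A (e x) (e y)" if "x \<noteq> y" for x y
    using cartan[of x y] that by (simp add: cartan_counterpart_def)
  have gram: "\<delta> a \<bullet> \<delta> b = of_int (cartan_matrix_A a b)" if "a < n" "b < n" for a b
    unfolding inner_D using that by (simp add: D_simple sum_simple_coordinates)
  have "independent_family (\<lambda>x. \<delta> (e x))"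
  proof (rule independent_family_inj)
    have "range (\<lambda>x. \<delta> (e x)) = \<delta> ` {..<n}"
      using image_image[of \<delta> e UNIV] e by (simp add: bij_betw_def)
    then show "independent (range (\<lambda>x. \<delta> (e x)))" using independent_simple by simp
    show "inj (\<lambda>x. \<delta> (e x))"
      using inj_simple e less by (auto simp: inj_def inj_on_def bij_betw_def)
  qed
  moreover have "\<bar>\<delta> (e x) \<bullet> \<delta> (e y)\<bar> = of_int \<bar>B $ x $ y\<bar>" if "x \<noteq> y" for x y
    unfolding gram[OF less less] entry[OF that, symmetric] by simp
  ultimately show "realises (\<lambda>x. \<delta> (e x)) B"
    using simple_root less by (auto simp: realises_def)
  have adjacent: "e x = Suc (e y) \<or> e y = Suc (e x)" if "B $ x $ y > 0" for x y
  proof -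
    have "x \<noteq> y" using that skew_symmetric_entry[OF skew, of x x] by auto
    then show ?thesis using entry[of x y] that by (auto simp: cartan_matrix_A_def split: if_splits)
  qed
  show "triangles_cyclic B"
    unfolding triangles_cyclic_def
  proof (intro allI impI notI)
    fix x y z assume "B $ x $ y > 0" "B $ y $ z > 0" "B $ x $ z > 0"
    from adjacent[OF this(1)] adjacent[OF this(2)] adjacent[OF this(3)] show False by linarith
  qed
qed

text \<open>
  The induction runs backwards from the orientation of the Dynkin diagram. Since mutation is an involution, each step
  of it is again a mutation.
\<close>

lemma exchange_matrix_triangles_cyclic:
  fixes B :: "int ^ 'v ^ 'v"
  assumes B: "exchange_matrix_A B" and n: "n = CARD('v)"
  shows "triangles_cyclic B"
proof -
  obtain B\<^sub>0 e where B\<^sub>0: "skew_symmetric B\<^sub>0" "bij_betw e (UNIV :: 'v set) {..<CARD('v)}"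
      "\<And>x y. cartan_counterpart B\<^sub>0 $ x $ y = cartan_matrix_A (e x) (e y)"
    and equiv: "mutation_equivalent B B\<^sub>0" and skew: "skew_symmetric B"
    using B by (auto simp: exchange_matrix_A_def)
  have "skew_symmetric B \<longrightarrow> (\<exists>\<gamma>. realises \<gamma> B) \<and> triangles_cyclic B"
    using equiv unfolding mutation_equivalent_def
  proof (induction rule: converse_rtranclp_induct)
    case base
    then show ?case using realises_linear_quiver[OF B\<^sub>0(1) _ B\<^sub>0(3)] B\<^sub>0(2) n by blast
  next
    case (step C C')
    show ?case
    proof
      assume skew_C: "skew_symmetric C"
      obtain k where C': "C' = mutation k C" using step.hyps by blast
      then have skew_C': "skew_symmetric C'" using skew_symmetric_mutation skew_C by blast
      then obtain \<gamma> where \<gamma>: "realises \<gamma> C'" and cyc: "triangles_cyclic C'" using step.IH by blast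
      have C: "C = mutation k C'" unfolding C' by (simp add: mutation_involution)
      show "(\<exists>\<gamma>. realises \<gamma> C) \<and> triangles_cyclic C"
        using realises_mutation[OF skew_C' \<gamma> cyc] triangles_cyclic_mutation[OF skew_C' \<gamma> cyc]
        unfolding C by blast
    qed
  qed
  then show ?thesis using skew by blast
qed

text \<open>
  Put \<open>K = c k\<close> and \<open>X x = a x * c x\<close>. The bounds required by \<open>abs_sum_signs\<close> hold because \<open>K\<close>,
  \<open>\<plusminus>X x\<close>, \<open>K + X x\<close>, \<open>K + X x + X y\<close> and \<open>\<plusminus>(X x - X y)\<close> are all coefficients of \<open>\<alpha>\<close> in some
  basis of roots.
\<close>

lemma mutated_coefficient:
  fixes \<gamma> :: "'v::finite \<Rightarrow> 'a" and c a :: "'v \<Rightarrow> int"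
  assumes skew: "skew_symmetric B" and real: "realises \<gamma> B" and cyc: "triangles_cyclic B"
    and span: "span (range \<gamma>) = UNIV"
    and \<alpha>: "\<alpha> \<in> \<Phi>" "\<alpha> = (\<Sum>y\<in>UNIV. of_int (c y) *\<^sub>R \<gamma> y)"
    and a: "\<And>x. of_int (a x) = \<gamma> x \<bullet> \<gamma> k"
  shows "\<bar>c k + (\<Sum>x | B $ x $ k > 0. a x * c x)\<bar> = \<bar>- \<bar>c k\<bar> + (\<Sum>x | B $ x $ k > 0. \<bar>c x\<bar>)\<bar>"
proof -
  let ?N = "{x. B $ x $ k > 0}"
  have roots: "\<gamma> x \<in> \<Phi>" for x using real by (auto simp: realises_def)
  obtain F :: "'v \<Rightarrow> 'a \<Rightarrow> real" where lin: "\<And>x. linear (F x)"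
    and F: "\<And>x y. F x (\<gamma> y) = of_bool (x = y)"
    using dual_functionals[of \<gamma>] real by (auto simp: realises_def)
  have F\<alpha>: "F x \<alpha> = of_int (c x)" for x
    unfolding \<alpha>(2) by (simp add: linear_sum[OF lin] linear_scale[OF lin] F)
  have kN: "k \<notin> ?N" using skew_symmetric_entry[OF skew, of k k] by simp
  have a1: "a x = 1 \<or> a x = -1" if "x \<in> ?N" for x
  proof -
    have "\<gamma> x \<bullet> \<gamma> k = 1 \<or> \<gamma> x \<bullet> \<gamma> k = -1"
      using realises_inner(2)[OF skew real, of x k] that kN by auto
    then show ?thesis unfolding a[symmetric] by linarith
  qed
  have orth: "\<gamma> x \<bullet> \<gamma> y = 0" if "x \<in> ?N" "y \<in> ?N" "x \<noteq> y" for x y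
  proof -
    have "\<not> B $ x $ y > 0" "\<not> B $ y $ x > 0"
      using cyc that by (auto simp: triangles_cyclic_def)
    then show ?thesis
      using realises_inner(1)[OF skew real that(3)] skew_symmetric_entry[OF skew, of x y] by simp
  qed
  have small: "\<bar>c x\<bar> \<le> 1" for x
  proof -
    have "range \<gamma> \<subseteq> \<Phi>" using roots by auto
    from functional_values[OF lin[of x] this span _ \<alpha>(1), of x]
    have "F x \<alpha> = 0 \<or> \<bar>F x \<alpha>\<bar> = 1" by (simp add: F)
    then show ?thesis unfolding F\<alpha> by linarith
  qed
  \<comment> \<open>Reflecting only the members of \<open>S\<close> in \<open>\<gamma> k\<close> gives a basis with this coefficient at \<open>k\<close>.\<close>
  have partial: "\<bar>c k + (\<Sum>x\<in>S. a x * c x)\<bar> \<le> 1" if S: "S \<subseteq> ?N" for S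
  proof -
    define r where "r x = (if x \<in> S then \<gamma> x \<bullet> \<gamma> k else 0)" for x
    let ?\<eta> = "\<lambda>x. \<gamma> x - r x *\<^sub>R \<gamma> k"
    let ?f = "\<lambda>v. F k v + (\<Sum>x\<in>S. of_int (a x) * F x v)"
    have rk: "r k = 0" using S kN by (auto simp: r_def)
    have "linear ?f"
      by (rule linearI) (simp_all add: linear_add[OF lin] linear_scale[OF lin] sum.distrib
          algebra_simps sum_distrib_left)
    moreover have "range ?\<eta> \<subseteq> \<Phi>"
      using roots reflection_root[OF roots[of k] roots] by (auto simp: r_def reflection_def)
    moreover have "span (range ?\<eta>) = UNIV" using span_transvection[OF span, of r k] rk by simp
    moreover have f\<gamma>: "?f (\<gamma> x) = of_bool (x = k) + r x" for x
    proof -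
      have "(\<Sum>y\<in>S. of_int (a y) * F y (\<gamma> x)) = (\<Sum>y\<in>S. if y = x then of_int (a y) else 0)"
        by (intro sum.cong) (auto simp: F)
      then show ?thesis by (simp add: F r_def a[symmetric])
    qed
    then have f\<eta>: "?f (?\<eta> x) = of_bool (x = k)" for x
    proof -
      have "?f (?\<eta> x) = ?f (\<gamma> x) - r x * ?f (\<gamma> k)"
        using linear_diff[OF \<open>linear ?f\<close>, of "\<gamma> x" "r x *\<^sub>R \<gamma> k"]
          linear_scale[OF \<open>linear ?f\<close>, of "r x" "\<gamma> k"] by simp
      then show ?thesis unfolding f\<gamma> by (simp add: rk)
    qed
    ultimately have "?f \<alpha> = 0 \<or> \<bar>?f \<alpha>\<bar> = \<bar>?f (?\<eta> k)\<bar>"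
      using functional_values[of ?f ?\<eta> k \<alpha>] \<alpha>(1) by simp
    then have "?f \<alpha> = 0 \<or> \<bar>?f \<alpha>\<bar> = 1" unfolding f\<eta> by simp
    moreover have "?f \<alpha> = of_int (c k + (\<Sum>x\<in>S. a x * c x))" by (simp add: F\<alpha>)
    ultimately show ?thesis by linarith
  qed
  \<comment> \<open>As \<open>\<gamma> x\<close> and \<open>\<gamma> y\<close> are orthogonal, reflecting \<open>\<gamma> k\<close> in both gives the root \<open>t\<close> below. With \<open>t\<close> in
    the place of \<open>\<gamma> y\<close>, the coefficient at \<open>x\<close> is, up to sign, the difference.\<close>
  have opposite: "\<bar>a x * c x - a y * c y\<bar> \<le> 1" if xy: "x \<in> ?N" "y \<in> ?N" "x \<noteq> y" for x y
  proof -
    define t where "t = \<gamma> k - of_int (a x) *\<^sub>R \<gamma> x - of_int (a y) *\<^sub>R \<gamma> y"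
    have k: "x \<noteq> k" "y \<noteq> k" using xy kN by auto
    have "reflection (\<gamma> y) (reflection (\<gamma> x) (\<gamma> k)) = t"
      using orth[OF xy] by (simp add: reflection_def t_def a inner_simps inner_commute)
    then have t: "t \<in> \<Phi>" using reflection_root roots by metis
    let ?\<eta> = "\<gamma>(y := t)"
    let ?f = "\<lambda>v. of_int (a x) * F x v - of_int (a y) * F y v"
    have "linear ?f"
      by (rule linearI) (simp_all add: linear_add[OF lin] linear_scale[OF lin] algebra_simps)
    moreover have "range ?\<eta> \<subseteq> \<Phi>" using roots t by auto
    moreover have "span (range ?\<eta>) = UNIV"
    proof (rule span_range_mono[OF _ span])
      fix z
      have "of_int (a y) *\<^sub>R (?\<eta> k - of_int (a x) *\<^sub>R ?\<eta> x - ?\<eta> y) \<in> span (range ?\<eta>)"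
        by (intro span_diff span_scale span_base rangeI)
      moreover have "of_int (a y) *\<^sub>R (?\<eta> k - of_int (a x) *\<^sub>R ?\<eta> x - ?\<eta> y) = \<gamma> y"
        using a1[OF xy(2)] xy(3) k by (auto simp: t_def)
      moreover have "\<gamma> z \<in> span (range ?\<eta>)" if "z \<noteq> y"
        using span_base[of "?\<eta> z" "range ?\<eta>"] that by simp
      ultimately show "\<gamma> z \<in> span (range ?\<eta>)" by (cases "z = y") auto
    qed
    moreover have "?f (?\<eta> z) = 0" if "z \<noteq> x" for z
      using that xy(3) k a1[OF xy(1)] a1[OF xy(2)]
      by (auto simp: t_def F linear_diff[OF lin] linear_scale[OF lin])
    ultimately have "?f \<alpha> = 0 \<or> \<bar>?f \<alpha>\<bar> = \<bar>?f (?\<eta> x)\<bar>"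
      using functional_values[of ?f ?\<eta> x \<alpha>] \<alpha>(1) by simp
    moreover have "\<bar>?f (?\<eta> x)\<bar> = 1" using xy(3) a1[OF xy(1)] by (auto simp: F)
    moreover have "?f \<alpha> = of_int (a x * c x - a y * c y)" by (simp add: F\<alpha>)
    ultimately show ?thesis by linarith
  qed
  have abs: "\<bar>a x * c x\<bar> = \<bar>c x\<bar>" if "x \<in> ?N" for x using a1[OF that] by auto
  have "\<bar>c k + (\<Sum>x\<in>?N. a x * c x)\<bar> = \<bar>- \<bar>c k\<bar> + (\<Sum>x\<in>?N. \<bar>a x * c x\<bar>)\<bar>"
  proof (rule abs_sum_signs)
    show "\<bar>c k\<bar> \<le> 1" by (rule small)
    show "\<bar>a x * c x\<bar> \<le> 1 \<and> \<bar>c k + a x * c x\<bar> \<le> 1" if "x \<in> ?N" for x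
      using partial[of "{x}"] small[of x] abs[OF that] that by simp
    show "\<bar>c k + (a x * c x + a y * c y)\<bar> \<le> 1 \<and> \<bar>a x * c x - a y * c y\<bar> \<le> 1"
      if "x \<in> ?N" "y \<in> ?N" "x \<noteq> y" for x y
      using partial[of "{x, y}"] opposite[OF that] that by simp
  qed simp
  then show ?thesis using abs by simp
qed

end

theorem corollary7p3:
  fixes B :: "int ^ 'v ^ 'v"
    and \<Phi> \<Delta> :: "'a::euclidean_space set"
    and \<gamma> :: "'v \<Rightarrow> 'a"
    and k :: 'v
    and \<alpha> :: 'a
    and d :: "'v \<Rightarrow> int"
  assumes "exchange_matrix_A B"
    and "root_system_A CARD('v) \<Phi>"
    and "\<forall>\<beta>\<in>\<Phi>. \<beta> \<bullet> \<beta> = 2"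
    and "root_base \<Phi> \<Delta>"
    and "companion_basis \<Phi> B \<gamma>"
    and "\<alpha> \<in> positive_roots \<Phi> \<Delta>"
    and "dvec \<gamma> \<alpha> = d"
  shows "\<forall>z. dvec (mutate_inwardly (quiver B) k \<gamma>) \<alpha> z =
           (if z \<noteq> k then d z else \<bar>- d k + (\<Sum>x | (x, k) \<in> quiver B. d x)\<bar>)"
proof
  fix z
  obtain \<delta> D where "type_A_coordinates \<Phi> CARD('v) \<delta> D"
    using type_A_coordinates_exist[OF assms(2,3)] .
  then interpret type_A_coordinates \<Phi> "CARD('v)" \<delta> D .
  have skew: "skew_symmetric B" using assms(1) by (simp add: exchange_matrix_A_def)
  have cyc: "triangles_cyclic B" by (rule exchange_matrix_triangles_cyclic[OF assms(1) refl])
  have \<alpha>: "\<alpha> \<in> \<Phi>" using assms(6) by (simp add: positive_roots_def)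
  obtain A where gram: "\<And>x y. of_int (A $ x $ y) = \<gamma> x \<bullet> \<gamma> y"
    and companion: "quasi_cartan_companion A B" and pos: "positive_definite A"
    and basis: "int_basis \<gamma> \<Phi>" and roots: "range \<gamma> \<subseteq> \<Phi>"
    using assms(5) by (auto simp: companion_basis_def)
  have ind: "independent_family \<gamma>" by (rule independent_family_gram[OF gram pos])
  have "\<bar>\<gamma> x \<bullet> \<gamma> y\<bar> = of_int \<bar>B $ x $ y\<bar>" if "x \<noteq> y" for x y
    using companion that unfolding gram[symmetric] quasi_cartan_companion_def
    by (metis of_int_abs)
  then have real: "realises \<gamma> B" using roots ind by (simp add: realises_def)
  have "\<Phi> \<subseteq> span (range \<gamma>)"
  proof
    fix v assume "v \<in> \<Phi>"
    then obtain c :: "'v \<Rightarrow> int" where "v = (\<Sum>y\<in>UNIV. of_int (c y) *\<^sub>R \<gamma> y)"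
      using int_basis_expansion[OF basis] by metis
    then show "v \<in> span (range \<gamma>)" by (auto intro!: span_sum span_scale intro: span_base)
  qed
  moreover have "span \<Phi> = UNIV"
    using assms(2) by (simp add: root_system_A_def root_system_def)
  ultimately have span: "span (range \<gamma>) = UNIV"
    using span_minimal[of \<Phi> "span (range \<gamma>)"] by auto
  obtain c :: "'v \<Rightarrow> int" where c: "\<alpha> = (\<Sum>y\<in>UNIV. of_int (c y) *\<^sub>R \<gamma> y)"
    using int_basis_expansion[OF basis \<alpha>] .
  have d: "d x = \<bar>c x\<bar>" for x using dvec_eq[OF ind c, of x] assms(7) by simp

  let ?N = "{x. B $ x $ k > 0}"
  have kN: "k \<notin> ?N" using skew_symmetric_entry[OF skew, of k k] by simp
  define r where "r x = (if x \<in> ?N then \<gamma> x \<bullet> \<gamma> k else 0)" for x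
  define s where "s = (\<Sum>x\<in>?N. A $ x $ k * c x)"
  let ?c' = "c(k := c k + s)"
  have \<eta>: "mutate_inwardly (quiver B) k \<gamma> = (\<lambda>x. \<gamma> x - r x *\<^sub>R \<gamma> k)"
    by (auto simp: mutate_inwardly_def quiver_def reflection_def r_def)
  have ind': "independent_family (\<lambda>x. \<gamma> x - r x *\<^sub>R \<gamma> k)"
    using kN by (intro independent_family_transvection ind) (simp add: r_def)
  have "(\<Sum>x\<in>UNIV. of_int (?c' x) * r x) = of_int s"
  proof -
    have "(\<Sum>x\<in>UNIV. of_int (?c' x) * r x) = (\<Sum>x\<in>UNIV. if x \<in> ?N then of_int (A $ x $ k * c x) else 0)"
      using kN by (intro sum.cong) (auto simp: r_def gram)
    then show ?thesis by (simp add: s_def sum.If_cases)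
  qed
  then have "(\<Sum>x\<in>UNIV. of_int (?c' x) *\<^sub>R (\<gamma> x - r x *\<^sub>R \<gamma> k)) = \<alpha>"
    unfolding transvection_sum[of "\<lambda>x. of_int (?c' x)"] by (subst c) (auto intro!: sum.cong)
  then have d': "dvec (mutate_inwardly (quiver B) k \<gamma>) \<alpha> z = \<bar>?c' z\<bar>"
    unfolding \<eta> by (intro dvec_eq[OF ind']) simp
  have "\<bar>c k + s\<bar> = \<bar>- \<bar>c k\<bar> + (\<Sum>x\<in>?N. \<bar>c x\<bar>)\<bar>"
    unfolding s_def
    using mutated_coefficient[OF skew real cyc span \<alpha> c, of "\<lambda>x. A $ x $ k" k] gram by simp
  then show "dvec (mutate_inwardly (quiver B) k \<gamma>) \<alpha> z =
      (if z \<noteq> k then d z else \<bar>- d k + (\<Sum>x | (x, k) \<in> quiver B. d x)\<bar>)"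
    unfolding d' by (simp add: d quiver_def)
qed

end
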